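(* For $x\in[0,1]$, $$\frac{p_{7}(x)}{35}=\frac{4}{\pi^6}\int_{0}^\infty I_{0}(xt)I_0(t)[K_0(t)]^6\,xt\,dt-\frac{2}{\pi^4}\int_{0}^\infty I_{0}(xt)[I_0(t)]^3[K_0(t)]^4\,xt\,dt.$$ Setting $$r_{7,k}=\frac{140}{4^{k}(k!)^{2}\pi^6}\int_{0}^\infty \left\{I_0(t)[K_0(t)]^6-\frac{\pi^2}{2}[I_0(t)]^3[K_0(t)]^4\right\}t^{2k+1}\,dt$$ for $k\in\mathbb Z_{\ge0}$, the Maclaurin series $$\sum_{k=0}^\infty r_{7,k}\,x^{2k+1}$$ converges uniformly to $p_7(x)$ for $x\in[0,1]$.
   Context: $J_0$ is the Bessel function of the first kind of order zero; $I_0(t)=\frac1\pi\int_0^\pi e^{t\cos\theta}\,d\theta$ and $K_0(t)=\int_0^\infty e^{-t\cosh u}\,du$ ($t>0$) are the modified Bessel functions of order zero. Kluyver's 7-step density for planar uniform random walks is $p_7(x)=\int_0^\infty J_0(xt)[J_0(t)]^7\,xt\,dt$. *)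

theory Defs
  imports "HOL-Analysis.Analysis"
begin

text \<open>The integrals below are Lebesgue integrals. Those defining \<open>I0 t\<close> for real \<open>t\<close>,
  \<open>K0 t\<close> for \<open>t > 0\<close>, \<open>p7 x\<close> for \<open>x \<ge> 0\<close> and \<open>r7 k\<close> converge absolutely
  (\<open>J0 t\<close> decays like \<open>t powr (-1/2)\<close>, and \<open>I0 t * K0 t\<close> like \<open>1 / (2 * t)\<close>, at
  infinity). Outer integrals range over the open half-line, so \<open>K0\<close> is evaluated only
  at positive arguments.\<close>

definition J0 :: "real \<Rightarrow> real" where
  "J0 t = (\<Sum>k. (-1) ^ k / (fact k)\<^sup>2 * (t / 2) ^ (2 * k))"

definition I0 :: "real \<Rightarrow> real" where
  "I0 t = 1 / pi * (LBINT \<theta>:{0..pi}. exp (t * cos \<theta>))"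

definition K0 :: "real \<Rightarrow> real" where
  "K0 t = (LBINT u:{0<..}. exp (- t * cosh u))"

definition p7 :: "real \<Rightarrow> real" where
  "p7 x = (LBINT t:{0<..}. J0 (x * t) * (J0 t) ^ 7 * (x * t))"

definition r7 :: "nat \<Rightarrow> real" where
  "r7 k = 140 / (4 ^ k * (fact k)\<^sup>2 * pi ^ 6) *
     (LBINT t:{0<..}. (I0 t * (K0 t) ^ 6 - pi\<^sup>2 / 2 * (I0 t) ^ 3 * (K0 t) ^ 4) * t ^ (2 * k + 1))"

end

theory Submission
  imports Defs "HOL-Complex_Analysis.Complex_Analysis" "HOL-Real_Asymp.Real_Asymp"
begin

text \<open>
  The proof is a Wick rotation. Let \<open>J\<close> be the entire function extending \<open>J0\<close>, so that
  \<open>J (\<i> * t) = I0 t\<close>, and let \<open>H\<close> be the Hankel function of the first kind, which is holomorphic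
  near the closed first quadrant without the origin and satisfies \<open>Re (H t) = J0 t\<close> and
  \<open>H (\<i> * t) = 2 / (pi * \<i>) * K0 t\<close> for \<open>t > 0\<close>. Consider
  \<open>J (x * z) * J z ^ k * H z ^ m * z\<close> with \<open>k + m = 7\<close>, \<open>m \<ge> 4\<close> and \<open>0 \<le> x \<le> 1\<close>. In the quadrant,
  \<open>J z\<close> and \<open>H z\<close> are of order \<open>exp (Im z) / sqrt \<bar>z\<bar>\<close> and \<open>exp (- Im z) / sqrt \<bar>z\<bar>\<close>. Since
  \<open>m \<ge> k + 1 \<ge> k + x\<close>, the exponentials do not grow, and what is left is
  \<open>O (\<bar>z\<bar> powr (-5/2))\<close>; at the origin the product stays bounded. Hence the integral along the
  positive real axis may be turned to the positive imaginary axis, where it becomes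
  \<open>- (2 / (pi * \<i>)) ^ m\<close> times the real moment of \<open>I0 (x * t) * I0 t ^ k * K0 t ^ m * t\<close>
  (lemma \<open>Bessel_product_integral\<close>).

  Taking real parts on the real axis yields four relations. For even \<open>m\<close> the right-hand sides are
  multiples of the two moments of the theorem; for odd \<open>m\<close> the rotated side is purely imaginary, so
  the integral of the real part vanishes. With \<open>h = j + \<i> * y\<close> the real parts of \<open>j * h ^ 6\<close>, \<open>j ^ 3 * h ^ 4\<close>,
  \<open>h ^ 7\<close> and \<open>j ^ 2 * h ^ 5\<close> are combinations of \<open>j ^ 7\<close>, \<open>j ^ 5 * y ^ 2\<close>, \<open>j ^ 3 * y ^ 4\<close> and
  \<open>j * y ^ 6\<close>, and one linear combination of them is exactly \<open>j ^ 7\<close>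
  (lemma \<open>seventh_power_eq_Re\<close>). This is the formula for \<open>p7\<close>
  (lemma \<open>p7_eq_IK_moments\<close>).

  The function \<open>H\<close> comes from \<open>K0\<close>. Substituting \<open>cosh u = 1 + y\<^sup>2 / w\<close> in the integral for \<open>K0 w\<close> gives
  \<open>2 * exp (- w)\<close> times the integral of \<open>exp (- y\<^sup>2) / sqrt (y\<^sup>2 + 2 * w)\<close> over \<open>y > 0\<close>. That
  formula makes sense beyond \<open>w > 0\<close>: it defines a holomorphic function, and it shows the decay
  \<open>exp (- Re w) / sqrt \<bar>w\<bar>\<close> wherever \<open>Re w \<ge> 0\<close>. What remains is the connection with \<open>J0\<close>
  on the imaginary axis (lemma \<open>Im_Macdonald_imaginary\<close>). There the same substitution describes the
  curve \<open>u = a + \<i> * arctan (sinh a)\<close>; moving it to the line \<open>Im u = pi / 2\<close>, on which the integrand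
  is real, leaves only the segment from \<open>0\<close> to \<open>\<i> * pi / 2\<close>, and this is Poisson's integral for \<open>J0\<close>.

  For the Maclaurin series the power series of \<open>I0\<close> is inserted in the two moments. All its terms
  are nonnegative and the moments are finite for \<open>x = 1\<close> too, so the series may be integrated
  termwise, and its coefficients at \<open>x = 1\<close> provide the majorant for uniform convergence.
\<close>

section \<open>The entire function behind \<open>J0\<close> and \<open>I0\<close>\<close>

definition Bessel_J :: "complex \<Rightarrow> complex" where
  "Bessel_J z = (\<Sum>k. (-1) ^ k / (fact k)\<^sup>2 * (z / 2) ^ (2 * k))"

lemma summable_Bessel_series:
  fixes y :: "'a :: {banach, real_normed_field}"
  shows "summable (\<lambda>k. (-1) ^ k / (fact k)\<^sup>2 * y ^ k)"
proof (rule summable_comparison_test)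
  show "\<exists>N. \<forall>n\<ge>N. norm ((-1) ^ n / (fact n)\<^sup>2 * y ^ n) \<le> norm y ^ n / fact n"
  proof (intro exI allI impI)
    fix n :: nat
    have f: "(fact n :: real) \<le> (fact n)\<^sup>2"
      by (rule self_le_power) auto
    have "norm ((-1) ^ n / (fact n)\<^sup>2 * y ^ n) = norm y ^ n / (fact n)\<^sup>2"
      by (simp add: norm_mult norm_divide norm_power)
    also have "\<dots> \<le> norm y ^ n / fact n"
      using f by (intro divide_left_mono mult_pos_pos) auto
    finally show "norm ((-1) ^ n / (fact n)\<^sup>2 * y ^ n) \<le> norm y ^ n / fact n" .
  qed
  show "summable (\<lambda>n. norm y ^ n / fact n)"
    using summable_exp[of "norm y"] by (simp add: field_simps)
qed

lemma Bessel_series_sums: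
  "(\<lambda>k. (-1) ^ k / (fact k)\<^sup>2 * (z / 2) ^ (2 * k)) sums Bessel_J z"
  unfolding Bessel_J_def
  using summable_Bessel_series[of "(z / 2)\<^sup>2"]
  by (intro summable_sums) (simp add: power_mult)

lemma Bessel_J_holomorphic [holomorphic_intros]:
  assumes "f holomorphic_on A"
  shows "(\<lambda>z. Bessel_J (f z)) holomorphic_on A"
proof -
  have 1: "(\<lambda>y. \<Sum>k. (-1) ^ k / (fact k)\<^sup>2 * y ^ k) holomorphic_on (UNIV :: complex set)"
    using termdiffs_strong_converges_everywhere[OF summable_Bessel_series]
    by (force simp: holomorphic_on_def field_differentiable_def)
  have "(\<lambda>y. \<Sum>k. (-1) ^ k / (fact k)\<^sup>2 * y ^ k) \<circ> (\<lambda>z. (f z / 2)\<^sup>2) holomorphic_on A"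
    by (rule holomorphic_on_compose_gen[OF _ 1]) (use assms in \<open>auto intro!: holomorphic_intros\<close>)
  then show ?thesis
    by (simp add: Bessel_J_def[abs_def] o_def power_mult)
qed

lemma Bessel_J_of_real: "Bessel_J (of_real t) = of_real (J0 t)"
proof -
  have "(\<lambda>k. of_real ((-1) ^ k / (fact k)\<^sup>2 * (t / 2) ^ (2 * k)) :: complex) sums Bessel_J (of_real t)"
    using Bessel_series_sums[of "of_real t"] by simp
  then have "Bessel_J (of_real t) = (\<Sum>k. of_real ((-1) ^ k / (fact k)\<^sup>2 * (t / 2) ^ (2 * k)))"
    by (simp add: sums_iff)
  also have "\<dots> = of_real (J0 t)"
    unfolding J0_def
    by (rule suminf_of_real[symmetric]) (use summable_Bessel_series[of "(t / 2)\<^sup>2"] in \<open>simp add: power_mult\<close>)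
  finally show ?thesis .
qed

lemma LBINT_FTC_Icc:
  fixes F :: "real \<Rightarrow> 'a::euclidean_space"
  assumes "a \<le> b"
    and "\<And>x. a \<le> x \<Longrightarrow> x \<le> b \<Longrightarrow> (F has_vector_derivative f x) (at x within {a..b})"
    and "continuous_on {a..b} f"
  shows "(LBINT x:{a..b}. f x) = F b - F a"
  unfolding set_lebesgue_integral_def using integral_FTC_Icc[of a b F f] assms by auto

lemma set_integrable_Icc_continuous:
  fixes f :: "real \<Rightarrow> 'a::{banach, second_countable_topology}"
  assumes "continuous_on {a..b} f"
  shows "set_integrable lborel {a..b} f"
  using borel_integrable_compact[of "{a..b}" f] assms
  by (simp add: set_integrable_def indicator_scaleR_eq_if)

definition cos_moment :: "nat \<Rightarrow> real" where
  "cos_moment n = (LBINT \<theta>:{0..pi}. cos \<theta> ^ n)"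

text \<open>The difference of the two integrands is the derivative of \<open>sin \<theta> * cos \<theta> ^ (n + 1)\<close>, a function
  that vanishes at both ends.\<close>

lemma cos_moment_rec: "(n + 2) * cos_moment (n + 2) = (n + 1) * cos_moment n"
proof -
  have 1: "(LBINT \<theta>:{0..pi}. (n + 2) * cos \<theta> ^ (n + 2) - (n + 1) * cos \<theta> ^ n)
        = sin pi * cos pi ^ (n + 1) - sin 0 * cos 0 ^ (n + 1)"
  proof (rule LBINT_FTC_Icc)
    fix x :: real
    have s: "sin x * sin x = 1 - cos x * cos x"
      using sin_squared_eq[of x] by (simp add: power2_eq_square)
    have "((\<lambda>x. sin x * cos x ^ (n + 1)) has_real_derivative
       cos x * cos x ^ (n + 1) - sin x * sin x * ((n + 1) * cos x ^ n)) (at x within {0..pi})"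
      by (rule derivative_eq_intros refl)+ (simp add: algebra_simps)
    also have "cos x * cos x ^ (n + 1) - sin x * sin x * ((n + 1) * cos x ^ n) =
        (n + 2) * cos x ^ (n + 2) - (n + 1) * cos x ^ n"
      unfolding s by (simp add: algebra_simps)
    finally have "((\<lambda>x. sin x * cos x ^ (n + 1)) has_real_derivative
       (n + 2) * cos x ^ (n + 2) - (n + 1) * cos x ^ n) (at x within {0..pi})" .
    then show "((\<lambda>x. sin x * cos x ^ (n + 1)) has_vector_derivative
       (n + 2) * cos x ^ (n + 2) - (n + 1) * cos x ^ n) (at x within {0..pi})"
      by (simp add: has_real_derivative_iff_has_vector_derivative)
  qed (auto intro!: continuous_intros)
  have "(LBINT \<theta>:{0..pi}. (n + 2) * cos \<theta> ^ (n + 2) - (n + 1) * cos \<theta> ^ n)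
     = (LBINT \<theta>:{0..pi}. (n + 2) * cos \<theta> ^ (n + 2)) - (LBINT \<theta>:{0..pi}. (n + 1) * cos \<theta> ^ n)"
    by (intro set_integral_diff set_integrable_Icc_continuous continuous_intros)
  also have "\<dots> = (n + 2) * cos_moment (n + 2) - (n + 1) * cos_moment n"
    by (simp only: cos_moment_def set_integral_mult_right)
  finally show ?thesis
    unfolding 1 by (simp add: add.commute)
qed

lemma cos_moment_0: "cos_moment 0 = pi"
  by (simp add: cos_moment_def set_lebesgue_integral_def)

lemma cos_moment_1: "cos_moment 1 = 0"
proof -
  have "cos_moment 1 = sin pi - sin 0"
    unfolding cos_moment_def
    by (rule LBINT_FTC_Icc)
       (auto intro!: continuous_intros derivative_eq_intros
             simp flip: has_real_derivative_iff_has_vector_derivative)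
  then show ?thesis by simp
qed

lemma cos_moment_odd: "cos_moment (2 * k + 1) = 0"
proof (induction k)
  case (Suc k)
  then show ?case using cos_moment_rec[of "2 * k + 1"] by simp
qed (use cos_moment_1 in simp)

lemma cos_moment_even: "cos_moment (2 * k) = pi * fact (2 * k) / (4 ^ k * (fact k)\<^sup>2)"
proof (induction k)
  case (Suc k)
  have "(2 * k + 2) * cos_moment (2 * Suc k) = (2 * k + 1) * cos_moment (2 * k)"
    using cos_moment_rec[of "2 * k"] by (simp add: add.commute)
  then have "cos_moment (2 * Suc k) = (2 * k + 1) * cos_moment (2 * k) / (2 * k + 2)"
    by (simp add: field_simps)
  also have "\<dots> = pi * fact (2 * Suc k) / (4 ^ Suc k * (fact (Suc k))\<^sup>2)"
    unfolding Suc.IH by (simp add: divide_simps) (simp add: algebra_simps power2_eq_square)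
  finally show ?case .
qed (simp add: cos_moment_0)

text \<open>Expand the exponential and integrate term by term: the odd moments of the cosine vanish, and the
  even ones turn the exponential series into the Bessel series.\<close>

lemma Bessel_J_Poisson: "Bessel_J z = 1 / pi * (LBINT \<theta>:{0..pi}. exp (\<i> * z * of_real (cos \<theta>)))"
proof -
  define f where "f n \<theta> = indicator {0..pi} \<theta> *\<^sub>R ((\<i> * z * of_real (cos \<theta>)) ^ n /\<^sub>R fact n)" for n and \<theta> :: real
  have int: "integrable lborel (f n)" for n
    using set_integrable_Icc_continuous[of 0 pi "\<lambda>\<theta>. (\<i> * z * of_real (cos \<theta>)) ^ n /\<^sub>R fact n"]
    by (simp add: f_def[abs_def] set_integrable_def continuous_intros)
  have nb: "norm (f n \<theta>) \<le> indicator {0..pi} \<theta> *\<^sub>R (norm z ^ n /\<^sub>R fact n)" for n \<theta>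
  proof -
    have "norm z * \<bar>cos \<theta>\<bar> \<le> norm z * 1" by (intro mult_left_mono) auto
    then have "(norm z * \<bar>cos \<theta>\<bar>) ^ n \<le> norm z ^ n" by (intro power_mono) auto
    then show ?thesis
      by (auto simp: f_def indicator_def norm_mult norm_power divide_simps)
  qed
  have sumn: "summable (\<lambda>n. norm (f n \<theta>))" for \<theta>
  proof (rule summable_comparison_test)
    show "\<exists>N. \<forall>n\<ge>N. norm (norm (f n \<theta>)) \<le> norm z ^ n /\<^sub>R fact n"
      by (intro exI allI impI, simp only: real_norm_def abs_norm_cancel, rule order_trans[OF nb]) (auto simp: indicator_def)
    show "summable (\<lambda>n. norm z ^ n /\<^sub>R fact n)"
      using summable_exp_generic[of "norm z"] by simp
  qed
  have sumi: "summable (\<lambda>n. LBINT \<theta>. norm (f n \<theta>))"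
  proof (rule summable_comparison_test)
    have "(LBINT \<theta>. norm (f n \<theta>)) \<le> (LBINT \<theta>. indicator {0..pi} \<theta> *\<^sub>R (norm z ^ n /\<^sub>R fact n))" for n
      using int nb by (intro integral_mono) auto
    then show "\<exists>N. \<forall>n\<ge>N. norm (LBINT \<theta>. norm (f n \<theta>)) \<le> pi * (norm z ^ n /\<^sub>R fact n)"
      by auto
    show "summable (\<lambda>n. pi * (norm z ^ n /\<^sub>R fact n))"
      using summable_exp_generic[of "norm z"] by (intro summable_mult) simp
  qed
  have "(\<lambda>n. LBINT \<theta>. f n \<theta>) sums (LBINT \<theta>. (\<Sum>n. f n \<theta>))"
    using int sumn sumi by (intro sums_integral) auto
  moreover have "(\<Sum>n. f n \<theta>) = indicator {0..pi} \<theta> *\<^sub>R exp (\<i> * z * of_real (cos \<theta>))" for \<theta>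
  proof -
    have "(\<lambda>n. f n \<theta>) sums (indicator {0..pi} \<theta> *\<^sub>R exp (\<i> * z * of_real (cos \<theta>)))"
      unfolding f_def by (intro sums_scaleR_right exp_converges)
    then show ?thesis by (simp add: sums_iff)
  qed
  moreover have "(LBINT \<theta>. f n \<theta>) = (\<i> * z) ^ n / fact n * of_real (cos_moment n)" for n
  proof -
    have "f n = (\<lambda>\<theta>. ((\<i> * z) ^ n / fact n) * of_real (indicator {0..pi} \<theta> *\<^sub>R cos \<theta> ^ n))"
      by (auto simp: f_def indicator_def fun_eq_iff power_mult_distrib scaleR_conv_of_real field_simps)
    then show ?thesis
      unfolding cos_moment_def set_lebesgue_integral_def
      by (simp only: integral_mult_right_zero integral_complex_of_real)
  qed
  ultimately have "(\<lambda>n. (\<i> * z) ^ n / fact n * of_real (cos_moment n)) sums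
      (LBINT \<theta>:{0..pi}. exp (\<i> * z * of_real (cos \<theta>)))"
    by (simp add: set_lebesgue_integral_def)
  moreover have "strict_mono (\<lambda>k::nat. 2 * k)"
    by (auto simp: strict_mono_def)
  moreover have "(\<i> * z) ^ n / fact n * of_real (cos_moment n) = 0" if "n \<notin> range (\<lambda>k::nat. 2 * k)" for n
  proof -
    from that have "odd n" by (auto elim: evenE)
    then show ?thesis using cos_moment_odd by (auto elim!: oddE)
  qed
  ultimately have "(\<lambda>k. (\<i> * z) ^ (2 * k) / fact (2 * k) * of_real (cos_moment (2 * k))) sums
      (LBINT \<theta>:{0..pi}. exp (\<i> * z * of_real (cos \<theta>)))"
    using sums_mono_reindex[of "\<lambda>k. 2 * k" "\<lambda>n. (\<i> * z) ^ n / fact n * of_real (cos_moment n)"] by simp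
  moreover have "(\<i> * z) ^ (2 * k) / fact (2 * k) * of_real (cos_moment (2 * k)) =
      of_real pi * ((-1) ^ k / (fact k)\<^sup>2 * (z / 2) ^ (2 * k))" for k
  proof -
    have "(\<i> * z) ^ (2 * k) = (-1) ^ k * z ^ (2 * k)"
      using power_mult_distrib[of "-1" "z\<^sup>2" k] by (simp add: power_mult power_mult_distrib)
    then show ?thesis
      unfolding cos_moment_even by (simp add: power_mult power_divide) (simp add: field_simps)
  qed
  ultimately have "(\<lambda>k. of_real pi * ((-1) ^ k / (fact k)\<^sup>2 * (z / 2) ^ (2 * k))) sums
      (LBINT \<theta>:{0..pi}. exp (\<i> * z * of_real (cos \<theta>)))"
    by simp
  moreover have "(\<lambda>k. of_real pi * ((-1) ^ k / (fact k)\<^sup>2 * (z / 2) ^ (2 * k))) sums (of_real pi * Bessel_J z)"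
    by (intro sums_mult Bessel_series_sums)
  ultimately have "(LBINT \<theta>:{0..pi}. exp (\<i> * z * of_real (cos \<theta>))) = of_real pi * Bessel_J z"
    by (rule sums_unique2)
  then show ?thesis by simp
qed

lemma Bessel_J_minus: "Bessel_J (- z) = Bessel_J z"
  by (simp add: Bessel_J_def)

text \<open>The definition of \<open>I0\<close> is Poisson's integral at \<open>- \<i> * t\<close>, and \<open>Bessel_J\<close> is even.\<close>

lemma Bessel_J_imaginary: "Bessel_J (\<i> * of_real t) = of_real (I0 t)"
proof -
  have "(\<lambda>\<theta>. exp (\<i> * - (\<i> * of_real t) * of_real (cos \<theta>)) :: complex) = (\<lambda>\<theta>. of_real (exp (t * cos \<theta>)))"
    by (simp add: exp_of_real flip: of_real_mult)
  then have "Bessel_J (- (\<i> * of_real t)) = of_real (I0 t)"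
    unfolding Bessel_J_Poisson I0_def by (simp only: set_integral_complex_of_real) simp
  then show ?thesis by (simp add: Bessel_J_minus)
qed

lemma I0_sums: "(\<lambda>k. (t / 2) ^ (2 * k) / (fact k)\<^sup>2) sums I0 t"
proof -
  have "(\<lambda>k. of_real ((t / 2) ^ (2 * k) / (fact k)\<^sup>2) :: complex) sums of_real (I0 t)"
  proof -
    have "(-1) ^ k / (fact k)\<^sup>2 * (\<i> * of_real t / 2) ^ (2 * k) =
        (of_real ((t / 2) ^ (2 * k) / (fact k)\<^sup>2) :: complex)" for k
    proof -
      have "(\<i> * of_real t / 2) ^ (2 * k) = (-1) ^ k * ((of_real t / 2) ^ (2 * k) :: complex)"
      proof -
        have "(\<i> * of_real t / 2)\<^sup>2 = -1 * (of_real t / 2 :: complex)\<^sup>2"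
          by (simp add: power_divide power_mult_distrib)
        then show ?thesis
          by (simp only: power_mult power_mult_distrib)
      qed
      then show ?thesis by simp
    qed
    then show ?thesis
      using Bessel_series_sums[of "\<i> * of_real t"] by (simp add: Bessel_J_imaginary)
  qed
  then show ?thesis by (simp only: sums_of_real_iff)
qed

section \<open>Growth of the Bessel function in the complex plane\<close>

lemma norm_exp_cos_le: "norm (exp (\<i> * z * of_real (cos \<theta>))) \<le> exp \<bar>Im z\<bar>"
proof -
  have "- (Im z * cos \<theta>) \<le> \<bar>Im z\<bar> * \<bar>cos \<theta>\<bar>"
    by (metis abs_ge_minus_self abs_mult)
  also have "\<dots> \<le> \<bar>Im z\<bar> * 1" by (intro mult_left_mono) auto
  finally show ?thesis by simp
qed

lemma Bessel_J_Poisson_integral: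
  "Bessel_J z = 1 / pi * integral {0..pi} (\<lambda>\<theta>. exp (\<i> * z * of_real (cos \<theta>)))"
proof -
  have "set_integrable lborel {0..pi} (\<lambda>\<theta>. exp (\<i> * z * of_real (cos \<theta>)))"
    by (intro set_integrable_Icc_continuous continuous_intros)
  from set_borel_integral_eq_integral(2)[OF this] show ?thesis
    unfolding Bessel_J_Poisson by simp
qed

lemma norm_Bessel_J_le_exp: "norm (Bessel_J z) \<le> exp \<bar>Im z\<bar>"
proof -
  have "norm (integral {0..pi} (\<lambda>\<theta>. exp (\<i> * z * of_real (cos \<theta>)))) \<le> exp \<bar>Im z\<bar> * (pi - 0)"
    by (intro integral_bound continuous_intros norm_exp_cos_le) auto
  then show ?thesis
    unfolding Bessel_J_Poisson_integral norm_mult by (simp add: norm_divide field_simps)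
qed

lemma half_le_sin:
  assumes "0 \<le> x" "x \<le> 1"
  shows "x / 2 \<le> sin (x::real)"
proof (cases "x = 0")
  case False
  then obtain \<xi> where \<xi>: "0 < \<xi>" "\<xi> < x" "sin x - sin 0 = (x - 0) * cos \<xi>"
    using MVT2[of 0 x sin cos] assms by (auto intro!: derivative_eq_intros)
  have "cos (pi / 3) \<le> cos \<xi>"
    using \<xi> assms pi_gt3 by (intro cos_monotone_0_pi_le) auto
  then have "x * (1 / 2) \<le> x * cos \<xi>"
    using assms by (intro mult_left_mono) (auto simp: cos_60)
  then show ?thesis using \<xi> by simp
qed auto

lemma integral_inverse_sin_squared:
  assumes "0 < \<delta>" "\<delta> \<le> pi / 2"
  shows "integral {\<delta>..pi - \<delta>} (\<lambda>\<theta>. 1 / (sin \<theta>)\<^sup>2) = 2 * cos \<delta> / sin \<delta>"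
proof -
  have "((\<lambda>\<theta>. 1 / (sin \<theta>)\<^sup>2) has_integral (- cos (pi - \<delta>) / sin (pi - \<delta>)) - (- cos \<delta> / sin \<delta>)) {\<delta>..pi - \<delta>}"
  proof (rule fundamental_theorem_of_calculus)
    fix x assume x: "x \<in> {\<delta>..pi - \<delta>}"
    then have "sin x > 0" using assms by (intro sin_gt_zero) auto
    then have "((\<lambda>x. - cos x / sin x) has_real_derivative (sin x * sin x + cos x * cos x) / (sin x * sin x))
        (at x within {\<delta>..pi - \<delta>})"
      by (auto intro!: derivative_eq_intros simp: diff_divide_distrib add_divide_distrib)
    then show "((\<lambda>x. - cos x / sin x) has_vector_derivative 1 / (sin x)\<^sup>2) (at x within {\<delta>..pi - \<delta>})"
      by (simp add: has_real_derivative_iff_has_vector_derivative power2_eq_square sin_cos_squared_add3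
          flip: power2_eq_square)
  qed (use assms in auto)
  then show ?thesis by (simp add: integral_unique)
qed

text \<open>Away from the stationary points \<open>0\<close> and \<open>pi\<close> of the phase \<open>z * cos \<theta>\<close>, integration by parts against
  \<open>1 / sin \<theta>\<close> gains a factor \<open>1 / \<bar>z\<bar>\<close> at the cost of \<open>1 / \<delta>\<close>, where \<open>\<delta>\<close> is the distance
  kept from these points.\<close>

lemma norm_integral_exp_cos_middle_le:
  assumes \<delta>: "0 < \<delta>" "\<delta> \<le> 1" 
  shows "norm z * norm (integral {\<delta>..pi - \<delta>} (\<lambda>\<theta>. exp (\<i> * z * of_real (cos \<theta>)))) \<le> 8 * exp \<bar>Im z\<bar> / \<delta>"
proof -
  define g where "g \<theta> = exp (\<i> * z * of_real (cos \<theta>))" for \<theta> :: real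
  define E where "E = exp \<bar>Im z\<bar>"
  let ?I = "{\<delta>..pi - \<delta>}"
  have le: "\<delta> \<le> pi - \<delta>" using \<delta> pi_gt3 by linarith
  have spos: "sin x > 0" if "x \<in> ?I" for x
    using that \<delta> by (intro sin_gt_zero) auto
  have sd: "sin \<delta> > 0" using spos[of \<delta>] le by simp
  have cg: "continuous_on A g" for A
    unfolding g_def by (intro continuous_intros)
  have nz: "of_real (sin x) \<noteq> (0::complex)" "sin x \<noteq> 0" "(sin x)\<^sup>2 \<noteq> 0" if "x \<in> ?I" for x
    using spos[OF that] by auto
  have ng: "norm (g x) \<le> E" for x
    unfolding g_def E_def by (rule norm_exp_cos_le)
  define h where "h \<theta> = g \<theta> * of_real (cos \<theta> / (sin \<theta>)\<^sup>2)" for \<theta>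
  have ch: "continuous_on ?I h"
    unfolding h_def using nz by (intro continuous_intros cg) auto
  have "((\<lambda>\<theta>. - (\<i> * z) * g \<theta> - h \<theta>) has_integral g (pi - \<delta>) / of_real (sin (pi - \<delta>)) - g \<delta> / of_real (sin \<delta>)) ?I"
  proof (rule fundamental_theorem_of_calculus[OF le])
    fix x assume x: "x \<in> ?I"
    have "((\<lambda>u. exp (\<i> * z * cos u) / sin u) has_field_derivative
        ((g x * (\<i> * z * of_real (- sin x))) * of_real (sin x) - g x * of_real (cos x)) / (of_real (sin x) * of_real (sin x)))
        (at (of_real x))"
      unfolding g_def using nz[OF x]
      by (auto intro!: derivative_eq_intros simp: sin_of_real cos_of_real)
    then have "((\<lambda>\<theta>. g \<theta> / of_real (sin \<theta>)) has_vector_derivative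
        ((g x * (\<i> * z * of_real (- sin x))) * of_real (sin x) - g x * of_real (cos x)) / (of_real (sin x) * of_real (sin x)))
        (at x within ?I)"
      unfolding g_def by (auto dest: has_vector_derivative_real_field simp: sin_of_real cos_of_real)
    then show "((\<lambda>\<theta>. g \<theta> / of_real (sin \<theta>)) has_vector_derivative - (\<i> * z) * g x - h x) (at x within ?I)"
      using nz[OF x] by (simp add: h_def field_simps power2_eq_square)
  qed
  then have eq: "integral ?I (\<lambda>\<theta>. - (\<i> * z) * g \<theta> - h \<theta>) = (g (pi - \<delta>) - g \<delta>) / of_real (sin \<delta>)"
    by (simp add: integral_unique diff_divide_distrib)
  have "integral ?I (\<lambda>\<theta>. - (\<i> * z) * g \<theta> - h \<theta>) = - (\<i> * z) * integral ?I g - integral ?I h"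
    by (subst integral_diff) (auto intro!: integrable_continuous_interval continuous_intros cg ch)
  then have "(\<i> * z) * integral ?I g = - integral ?I (\<lambda>\<theta>. - (\<i> * z) * g \<theta> - h \<theta>) - integral ?I h"
    by (simp only: minus_diff_eq mult_minus_left diff_minus_eq_add) simp
  with eq have "(\<i> * z) * integral ?I g = - ((g (pi - \<delta>) - g \<delta>) / of_real (sin \<delta>)) - integral ?I h"
    by simp
  then have "norm z * norm (integral ?I g) \<le> norm ((g (pi - \<delta>) - g \<delta>) / of_real (sin \<delta>)) + norm (integral ?I h)"
    by (metis (no_types, lifting) mult_1 norm_ii norm_minus_cancel norm_mult norm_triangle_ineq4)
  also have "norm ((g (pi - \<delta>) - g \<delta>) / of_real (sin \<delta>)) \<le> (E + E) / sin \<delta>"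
    using sd ng[of "pi - \<delta>"] ng[of \<delta>] norm_triangle_ineq4[of "g (pi - \<delta>)" "g \<delta>"]
    by (auto simp: norm_divide intro!: divide_right_mono)
  also have "norm (integral ?I h) \<le> integral ?I (\<lambda>\<theta>. E * (1 / (sin \<theta>)\<^sup>2))"
  proof (rule integral_norm_bound_integral)
    show "h integrable_on ?I" by (intro integrable_continuous_interval ch)
    show "(\<lambda>\<theta>. E * (1 / (sin \<theta>)\<^sup>2)) integrable_on ?I"
      using nz by (intro integrable_continuous_interval continuous_intros) auto
    fix x assume "x \<in> ?I"
    have "norm (h x) = norm (g x) * (\<bar>cos x\<bar> / (sin x)\<^sup>2)"
      by (simp add: h_def norm_mult norm_divide norm_power)
    also have "\<dots> \<le> E * (1 / (sin x)\<^sup>2)"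
      by (intro mult_mono ng divide_right_mono) (auto simp: E_def)
    finally show "norm (h x) \<le> E * (1 / (sin x)\<^sup>2)" .
  qed
  also have "\<dots> = E * (2 * cos \<delta> / sin \<delta>)"
    using integral_inverse_sin_squared[of \<delta>] \<delta> pi_gt3
    by (subst Henstock_Kurzweil_Integration.integral_mult_right) simp
  also have "\<dots> \<le> E * (2 * 1 / sin \<delta>)"
    using sd by (intro mult_left_mono divide_right_mono) (auto simp: E_def)
  finally have "norm z * norm (integral ?I g) \<le> 4 * E / sin \<delta>"
    by (simp add: add_divide_distrib algebra_simps)
  also have "\<dots> \<le> 4 * E / (\<delta> / 2)"
    using half_le_sin[of \<delta>] \<delta> sd by (intro divide_left_mono mult_pos_pos) (auto simp: E_def)
  finally show ?thesis by (simp add: g_def[abs_def] E_def)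
qed

text \<open>The two end pieces of length \<open>\<delta>\<close> are bounded trivially; \<open>\<delta> = 1 / sqrt \<bar>z\<bar>\<close> balances them
  against the middle piece. The bound holds in every direction, which is what the rotation
  of a contour needs.\<close>

lemma norm_Bessel_J_le:
  assumes "z \<noteq> 0"
  shows "norm (Bessel_J z) \<le> 4 * exp \<bar>Im z\<bar> / sqrt (norm z)"
proof (cases "norm z \<le> 1")
  case True
  have "exp \<bar>Im z\<bar> \<le> 4 * exp \<bar>Im z\<bar> / 1" by simp
  also have "\<dots> \<le> 4 * exp \<bar>Im z\<bar> / sqrt (norm z)"
    using True assms by (intro divide_left_mono) auto
  finally show ?thesis using norm_Bessel_J_le_exp[of z] by linarith
next
  case False
  define g where "g \<theta> = exp (\<i> * z * of_real (cos \<theta>))" for \<theta> :: real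
  define E where "E = exp \<bar>Im z\<bar>"
  define \<delta> where "\<delta> = 1 / sqrt (norm z)"
  have \<delta>: "0 < \<delta>" "\<delta> \<le> 1" and z: "norm z = 1 / (\<delta> * \<delta>)"
    using False assms by (auto simp: \<delta>_def)
  have le: "\<delta> \<le> pi - \<delta>" using \<delta> pi_gt3 by linarith
  have cg: "continuous_on A g" for A
    unfolding g_def by (intro continuous_intros)
  have ng: "norm (g x) \<le> E" for x
    unfolding g_def E_def by (rule norm_exp_cos_le)
  have "integral {0..pi} g = integral {0..\<delta>} g + integral {\<delta>..pi} g"
    by (rule Henstock_Kurzweil_Integration.integral_combine[symmetric]) (use \<delta> le in \<open>auto intro!: integrable_continuous_interval cg\<close>)
  also have "integral {\<delta>..pi} g = integral {\<delta>..pi - \<delta>} g + integral {pi - \<delta>..pi} g"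
    by (rule Henstock_Kurzweil_Integration.integral_combine[symmetric]) (use \<delta> le in \<open>auto intro!: integrable_continuous_interval cg\<close>)
  finally have "norm (integral {0..pi} g) \<le> norm (integral {0..\<delta>} g) + (norm (integral {\<delta>..pi - \<delta>} g) + norm (integral {pi - \<delta>..pi} g))"
    using norm_triangle_ineq[of "integral {\<delta>..pi - \<delta>} g" "integral {pi - \<delta>..pi} g"]
      norm_triangle_ineq[of "integral {0..\<delta>} g" "integral {\<delta>..pi - \<delta>} g + integral {pi - \<delta>..pi} g"]
    by simp
  also have "norm (integral {0..\<delta>} g) \<le> E * (\<delta> - 0)"
    using \<delta> by (intro integral_bound cg ng) auto
  also have "norm (integral {pi - \<delta>..pi} g) \<le> E * (pi - (pi - \<delta>))"
    using \<delta> by (intro integral_bound cg ng) auto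
  also have "norm (integral {\<delta>..pi - \<delta>} g) \<le> 8 * E * \<delta>"
    using norm_integral_exp_cos_middle_le[OF \<delta>, of z] \<delta> unfolding z g_def[symmetric, abs_def] E_def[symmetric]
    by (simp add: field_simps)
  finally have "norm (integral {0..pi} g) \<le> 10 * E * \<delta>" by simp
  also have "\<dots> \<le> 4 * pi * E * \<delta>"
    using \<delta> pi_gt3 by (intro mult_right_mono) (auto simp: E_def)
  finally have "norm (Bessel_J z) \<le> 4 * E * \<delta>"
    unfolding Bessel_J_Poisson_integral g_def[symmetric] norm_mult by (simp add: norm_divide field_simps)
  then show ?thesis by (simp add: E_def \<delta>_def)
qed

section \<open>The modified Bessel function \<open>K0\<close> on a half-plane\<close>

lemma set_integrable_powr_exp:
  fixes a c :: real
  assumes "a > 0" "c > 0"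
  shows "set_integrable lborel {0<..} (\<lambda>y. y powr (a - 1) * exp (- (c * y)))"
proof -
  have "(\<lambda>t. complex_of_real t powr (of_real a - 1) / of_real (exp (c * t))) absolutely_integrable_on {0<..}"
    using assms by (intro absolutely_integrable_Gamma_integral) auto
  then have "(\<lambda>t. norm (complex_of_real t powr (of_real a - 1) / of_real (exp (c * t)))) absolutely_integrable_on {0<..}"
    by (rule absolutely_integrable_norm[unfolded o_def])
  also have "?this \<longleftrightarrow> (\<lambda>y. y powr (a - 1) * exp (- (c * y))) absolutely_integrable_on {0<..}"
    by (intro set_integrable_cong refl)
       (auto simp: norm_divide norm_powr_real_powr exp_minus field_simps)
  finally show ?thesis
    unfolding set_integrable_def
    by (subst (asm) integrable_completion) auto
qed

lemma set_integrable_exp: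
  assumes "c > 0"
  shows "set_integrable lborel {0<..} (\<lambda>y::real. exp (- (c * y)))"
proof -
  have "set_integrable lborel {0<..} (\<lambda>y::real. y powr (1 - 1) * exp (- (c * y)))"
    using assms by (intro set_integrable_powr_exp) auto
  also have "?this \<longleftrightarrow> ?thesis"
    by (intro set_integrable_cong) auto
  finally show ?thesis .
qed

text \<open>Trading the Gaussian for an exponential makes the Gamma integral a majorant.\<close>

lemma gaussian_le_exp: "exp (- (y\<^sup>2)) \<le> 2 * exp (- y)" for y :: real
proof -
  have "3 / 4 \<le> exp (- 1 / 4 :: real)"
    using exp_ge_add_one_self[of "- 1 / 4 :: real"] by simp
  then have "1 / 2 \<le> exp (- 1 / 4 :: real)" by simp
  then have "exp (1 / 4 :: real) \<le> 2"
    by (simp add: exp_minus field_simps)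
  moreover have "0 \<le> (y - 1 / 2)\<^sup>2" by simp
  then have "- (y\<^sup>2) \<le> 1 / 4 + - y"
    by (simp add: power2_diff power_divide)
  then have "exp (- (y\<^sup>2)) \<le> exp (1 / 4) * exp (- y)"
    by (simp flip: exp_add)
  ultimately show ?thesis
    by (meson exp_ge_zero mult_right_mono order_trans)
qed

lemma set_integrable_continuous_bound:
  fixes f :: "real \<Rightarrow> 'a::{banach, second_countable_topology}" and g :: "real \<Rightarrow> real"
  assumes "continuous_on {0<..} f"
    and "set_integrable lborel {0<..} g"
    and "\<And>x. x > 0 \<Longrightarrow> norm (f x) \<le> g x"
  shows "set_integrable lborel {0<..} f"
proof (rule set_integrable_bound[OF assms(2)])
  show "set_borel_measurable lborel {0<..} f"
    using borel_measurable_continuous_on_indicator[OF _ assms(1)]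
    by (simp add: set_borel_measurable_def)
  show "AE x\<in>{0<..} in lborel. norm (f x) \<le> norm (g x)"
    using assms(3) by (force intro!: AE_I2)
qed

lemma set_integrable_gaussian: "set_integrable lborel {0<..} (\<lambda>y::real. exp (- (y\<^sup>2)))"
proof (rule set_integrable_continuous_bound)
  show "set_integrable lborel {0<..} (\<lambda>y::real. 2 * exp (- (1 * y)))"
    by (intro set_integrable_mult_right set_integrable_exp) simp
qed (auto intro!: continuous_intros gaussian_le_exp)

lemma norm_set_integral_le:
  fixes f :: "real \<Rightarrow> 'a::{banach, second_countable_topology}" and g :: "real \<Rightarrow> real"
  assumes "set_integrable lborel A f" "set_integrable lborel A g"
    and "\<And>x. x \<in> A \<Longrightarrow> norm (f x) \<le> g x"
  shows "norm (LBINT x:A. f x) \<le> (LBINT x:A. g x)"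
  unfolding set_lebesgue_integral_def
  using assms unfolding set_integrable_def
  by (intro order_trans[OF integral_norm_bound] integral_mono integrable_norm) (auto simp: indicator_def)

text \<open>
  The analytic continuation of \<open>K0\<close>. For \<open>w > 0\<close> it arises from the substitution
  \<open>y = sqrt (2 * w) * sinh (u / 2)\<close>, that is \<open>y\<^sup>2 = w * (cosh u - 1)\<close>. The factor \<open>exp (- y\<^sup>2)\<close> does
  not depend on \<open>w\<close>, so the integral converges absolutely also on the imaginary axis, where
  the integral defining \<open>K0\<close> would not.
\<close>

definition Macdonald :: "complex \<Rightarrow> complex" where
  "Macdonald w = 2 * exp (- w) * (LBINT y:{0<..}. of_real (exp (- (y\<^sup>2))) / csqrt (of_real (y\<^sup>2) + 2 * w))"

text \<open>The half-plane \<open>Im w < Re w\<close> is convex, avoids the cut of the square root, and contains the closed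
  fourth quadrant without the origin. The quantity \<open>Re w - Im w\<close> measures the distance from its boundary.\<close>

lemma halfplane_norm_ge: "Re v - Im v \<le> 2 * norm v"
  using abs_Re_le_cmod[of v] abs_Im_le_cmod[of v] by linarith

lemma halfplane_not_nonpos_Reals: "Im v < Re v \<Longrightarrow> v \<notin> \<real>\<^sub>\<le>\<^sub>0"
  by (auto elim!: nonpos_Reals_cases)

lemma isCont_Macdonald_integrand:
  assumes "Im w < Re w"
  shows "isCont (\<lambda>y. of_real (exp (- (y\<^sup>2))) / csqrt (of_real (y\<^sup>2) + 2 * w)) y"
proof -
  have "Im w * 2 < y\<^sup>2 + Re w * 2"
    using assms zero_le_power2[of y] by linarith
  then have "Im (of_real (y\<^sup>2) + 2 * w) < Re (of_real (y\<^sup>2) + 2 * w)"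
    by (simp flip: of_real_power)
  then have "of_real (y\<^sup>2) + 2 * w \<notin> \<real>\<^sub>\<le>\<^sub>0"
    by (rule halfplane_not_nonpos_Reals)
  moreover from this have "of_real (y\<^sup>2) + 2 * w \<noteq> 0" by auto
  ultimately show ?thesis
    by (intro continuous_intros isCont_csqrt') auto
qed

lemma set_integrable_Macdonald:
  assumes "Im w < Re w"
  shows "set_integrable lborel {0<..} (\<lambda>y. of_real (exp (- (y\<^sup>2))) / csqrt (of_real (y\<^sup>2) + 2 * w))"
proof (rule set_integrable_continuous_bound)
  let ?q = "\<lambda>y. of_real (y\<^sup>2) + 2 * w"
  define \<delta> where "\<delta> = Re w - Im w"
  show "continuous_on {0<..} (\<lambda>y. of_real (exp (- (y\<^sup>2))) / csqrt (?q y))"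
    by (intro continuous_at_imp_continuous_on ballI isCont_Macdonald_integrand assms)
  show "set_integrable lborel {0<..} (\<lambda>y. 1 / sqrt \<delta> * exp (- (y\<^sup>2)))"
    by (intro set_integrable_mult_right set_integrable_gaussian)
  fix y :: real
  have "2 * \<delta> \<le> Re (?q y) - Im (?q y)"
    by (simp add: \<delta>_def flip: of_real_power)
  then have "\<delta> \<le> norm (?q y)"
    using halfplane_norm_ge[of "?q y"] by simp
  moreover have "\<delta> > 0" using assms by (simp add: \<delta>_def)
  ultimately have "exp (- (y\<^sup>2)) / sqrt (norm (?q y)) \<le> exp (- (y\<^sup>2)) / sqrt \<delta>"
    by (intro divide_left_mono mult_pos_pos) auto
  then show "norm (of_real (exp (- (y\<^sup>2))) / csqrt (?q y)) \<le> 1 / sqrt \<delta> * exp (- (y\<^sup>2))"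
    by (simp add: norm_divide)
qed

text \<open>A second-order remainder that is uniform on a half-plane. It makes it possible to differentiate
  under the integral sign by integrating the remainder.\<close>

lemma inverse_csqrt_Taylor:
  assumes "\<delta> > 0" "Re a - Im a > \<delta>" "Re b - Im b > \<delta>"
  shows "norm (1 / csqrt b - 1 / csqrt a - (-1 / (2 * a * csqrt a)) * (b - a))
      \<le> 3 / (4 * (\<delta> / 2)\<^sup>2 * sqrt (\<delta> / 2)) * norm (b - a) ^ 2"
proof -
  define S where "S = {v. \<delta> < Re v - Im v}"
  define f where "f i v = (if i = 0 then 1 / csqrt v
      else if i = 1 then - 1 / (2 * v * csqrt v) else 3 / (4 * v\<^sup>2 * csqrt v))" for i :: nat and v
  have conv: "convex S"
  proof -
    have "S = {v. v \<bullet> (1 - \<i>) > \<delta>}"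
      by (auto simp: S_def inner_complex_def)
    then show ?thesis
      using convex_halfspace_gt[of \<delta> "1 - \<i>"] by (simp add: inner_commute)
  qed
  have nr: "v \<notin> \<real>\<^sub>\<le>\<^sub>0" if "v \<in> S" for v
    using that assms by (intro halfplane_not_nonpos_Reals) (auto simp: S_def)
  have nn: "norm v \<ge> \<delta> / 2" if "v \<in> S" for v
    using that halfplane_norm_ge[of v] by (auto simp: S_def)
  have "norm (f 0 b - (\<Sum>i\<le>1. f i a * (b - a) ^ i / fact i)) \<le> 3 / (4 * (\<delta> / 2)\<^sup>2 * sqrt (\<delta> / 2)) * norm (b - a) ^ Suc 1 / fact 1"
  proof (rule complex_Taylor[OF conv])
    show "a \<in> S" "b \<in> S" using assms by (auto simp: S_def)
    fix v assume v: "v \<in> S"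
    then have vn: "v \<notin> \<real>\<^sub>\<le>\<^sub>0" "v \<noteq> 0" using nr[of v] by auto
    have sq: "csqrt v * csqrt v = v" by (metis power2_csqrt power2_eq_square)
    have "norm (f (Suc 1) v) = 3 / (4 * (norm v)\<^sup>2 * sqrt (norm v))"
      by (simp add: f_def norm_divide norm_mult norm_power)
    also have "\<dots> \<le> 3 / (4 * (\<delta> / 2)\<^sup>2 * sqrt (\<delta> / 2))"
      using nn[OF v] assms vn by (intro divide_left_mono mult_mono mult_pos_pos power_mono) auto
    finally show "norm (f (Suc 1) v) \<le> 3 / (4 * (\<delta> / 2)\<^sup>2 * sqrt (\<delta> / 2))" .
    fix i :: nat assume "i \<le> 1"
    then consider "i = 0" | "i = 1" by linarith
    then show "(f i has_field_derivative f (Suc i) v) (at v within S)"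
    proof cases
      case 1
      have "((\<lambda>v. 1 / csqrt v) has_field_derivative - (1 / (2 * csqrt v)) / (csqrt v * csqrt v)) (at v within S)"
        using vn by (auto intro!: derivative_eq_intros)
      then show ?thesis using 1 vn by (simp add: f_def[abs_def] sq mult_ac)
    next
      case 2
      have "((\<lambda>v. - 1 / (2 * v * csqrt v)) has_field_derivative
          (2 * csqrt v + 2 * v * (1 / (2 * csqrt v))) / ((2 * v * csqrt v) * (2 * v * csqrt v))) (at v within S)"
        using vn by (auto intro!: derivative_eq_intros simp: diff_divide_distrib add_divide_distrib)
      also have "(2 * csqrt v + 2 * v * (1 / (2 * csqrt v))) / ((2 * v * csqrt v) * (2 * v * csqrt v)) = 3 / (4 * v\<^sup>2 * csqrt v)"
      proof -
        define p where "p = csqrt v"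
        have p: "csqrt v = p" "v = p\<^sup>2" "p \<noteq> 0"
          using vn by (auto simp: p_def)
        show ?thesis unfolding p(1) using p(3) by (simp add: p(2) field_simps power2_eq_square)
      qed
      finally show ?thesis using 2 by (simp add: f_def[abs_def])
    qed
  qed
  then show ?thesis
    by (simp add: f_def power2_eq_square diff_diff_eq2 add.commute diff_add_eq)
qed

lemma has_field_derivative_if_quadratic_error:
  fixes f :: "complex \<Rightarrow> complex"
  assumes "\<forall>\<^sub>F w in at a. norm (f w - f a - D * (w - a)) \<le> K * norm (w - a) ^ 2"
  shows "(f has_field_derivative D) (at a)"
proof -
  have "((\<lambda>w. (f w - f a) / (w - a) - D) \<longlongrightarrow> 0) (at a)"
  proof (rule Lim_null_comparison)
    show "\<forall>\<^sub>F w in at a. norm ((f w - f a) / (w - a) - D) \<le> K * norm (w - a)"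
      using assms eventually_neq_at_within[of a a UNIV]
    proof eventually_elim
      case (elim w)
      then have "(f w - f a) / (w - a) - D = (f w - f a - D * (w - a)) / (w - a)"
        by (simp add: field_simps)
      also have "norm \<dots> \<le> K * norm (w - a) ^ 2 / norm (w - a)"
        unfolding norm_divide using elim by (intro divide_right_mono) auto
      also have "\<dots> = K * norm (w - a)"
        using elim by (simp add: power2_eq_square)
      finally show ?case .
    qed
    show "((\<lambda>w. K * norm (w - a)) \<longlongrightarrow> 0) (at a)"
      by (auto intro!: tendsto_eq_intros)
  qed
  then show ?thesis
    unfolding has_field_derivative_iff by (simp add: LIM_zero_iff)
qed

lemma Macdonald_has_derivative:
  assumes w0: "Im a < Re a"
  shows "\<exists>D. (Macdonald has_field_derivative D) (at a)"
proof -
  define q where "q y w = of_real (y\<^sup>2) + 2 * w" for y :: real and w :: complex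
  define e where "e y = complex_of_real (exp (- (y\<^sup>2)))" for y :: real
  define G where "G w = (LBINT y:{0<..}. e y / csqrt (q y w))" for w
  define d where "d y = e y * (- 1 / (q y a * csqrt (q y a)))" for y
  define \<delta> where "\<delta> = Re a - Im a"
  define B where "B = 3 / (4 * (\<delta> / 2)\<^sup>2 * sqrt (\<delta> / 2))"
  have \<delta>: "\<delta> > 0" using assms by (simp add: \<delta>_def)
  have qa: "\<delta> < Re (q y w) - Im (q y w)" if "\<delta> / 2 < Re w - Im w" for y w
  proof -
    have "Re (q y w) - Im (q y w) = y\<^sup>2 + 2 * (Re w - Im w)"
      by (simp add: q_def flip: of_real_power)
    moreover have "\<delta> < 2 * (Re w - Im w)" using that by simp
    moreover have "0 \<le> y\<^sup>2" by simp
    ultimately show ?thesis by linarith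
  qed
  have da: "\<delta> / 2 < Re a - Im a" using \<delta> by (simp add: \<delta>_def)
  have nr: "q y w \<notin> \<real>\<^sub>\<le>\<^sub>0" "q y w \<noteq> 0" if "\<delta> / 2 < Re w - Im w" for y w
  proof -
    show "q y w \<notin> \<real>\<^sub>\<le>\<^sub>0"
      using qa[OF that, of y] \<delta> by (intro halfplane_not_nonpos_Reals) auto
    then show "q y w \<noteq> 0" by auto
  qed
  have int: "set_integrable lborel {0<..} (\<lambda>y. e y / csqrt (q y w))" if "\<delta> / 2 < Re w - Im w" for w
    unfolding e_def q_def using that \<delta> by (intro set_integrable_Macdonald) auto
  have intd: "set_integrable lborel {0<..} d"
  proof (rule set_integrable_continuous_bound)
    show "continuous_on {0<..} d"
      unfolding d_def e_def using nr[OF da] unfolding q_def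
      by (intro continuous_at_imp_continuous_on ballI continuous_intros isCont_csqrt') auto
    show "set_integrable lborel {0<..} (\<lambda>y. 1 / (\<delta> / 2 * sqrt (\<delta> / 2)) * exp (- (y\<^sup>2)))"
      by (intro set_integrable_mult_right set_integrable_gaussian)
    fix y :: real
    have n: "\<delta> / 2 \<le> norm (q y a)"
      using qa[OF da, of y] halfplane_norm_ge[of "q y a"] by simp
    have "norm (d y) = exp (- (y\<^sup>2)) * (1 / (norm (q y a) * sqrt (norm (q y a))))"
      by (simp add: d_def e_def norm_mult norm_divide)
    also have "\<dots> \<le> exp (- (y\<^sup>2)) * (1 / (\<delta> / 2 * sqrt (\<delta> / 2)))"
      using n \<delta> by (intro mult_left_mono divide_left_mono mult_mono mult_pos_pos) auto
    finally show "norm (d y) \<le> 1 / (\<delta> / 2 * sqrt (\<delta> / 2)) * exp (- (y\<^sup>2))" by (simp add: mult_ac)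
  qed
  have "(G has_field_derivative (LBINT y:{0<..}. d y)) (at a)"
  proof (rule has_field_derivative_if_quadratic_error)
    have "open {w. \<delta> / 2 < Re w - Im w}"
      by (intro open_Collect_less continuous_intros)
    then have "\<forall>\<^sub>F w in nhds a. \<delta> / 2 < Re w - Im w"
      using da eventually_nhds_in_open by fastforce
    then have "\<forall>\<^sub>F w in at a. \<delta> / 2 < Re w - Im w"
      by (simp add: eventually_at_filter eventually_mono)
    then show "\<forall>\<^sub>F w in at a. norm (G w - G a - (LBINT y:{0<..}. d y) * (w - a))
        \<le> 4 * B * (LBINT y:{0<..}. exp (- (y\<^sup>2))) * norm (w - a) ^ 2"
    proof eventually_elim
      case (elim w)
      have eq: "G w - G a - (LBINT y:{0<..}. d y) * (w - a)
          = (LBINT y:{0<..}. e y / csqrt (q y w) - e y / csqrt (q y a) - d y * (w - a))"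
        unfolding G_def
        by (subst set_integral_diff set_integral_mult_left;
            (intro set_integral_diff set_integrable_mult_left int intd elim da)?)+ simp
      have bd: "norm (e y / csqrt (q y w) - e y / csqrt (q y a) - d y * (w - a)) \<le> 4 * B * norm (w - a) ^ 2 * exp (- (y\<^sup>2))" for y
      proof -
        have "norm (1 / csqrt (q y w) - 1 / csqrt (q y a) - (-1 / (2 * q y a * csqrt (q y a))) * (q y w - q y a))
           \<le> B * norm (q y w - q y a) ^ 2"
          unfolding B_def by (intro inverse_csqrt_Taylor \<delta> qa elim da)
        moreover have qd: "q y w - q y a = 2 * (w - a)" by (simp add: q_def)
        then have "(-1 / (2 * q y a * csqrt (q y a))) * (q y w - q y a) = (-1 / (q y a * csqrt (q y a))) * (w - a)"
          unfolding qd using nr[OF da, of y] by (simp add: field_simps)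
        moreover have "norm (q y w - q y a) ^ 2 = 4 * norm (w - a) ^ 2"
          unfolding qd norm_mult by (simp add: power_mult_distrib)
        ultimately have n: "norm (1 / csqrt (q y w) - 1 / csqrt (q y a) - (-1 / (q y a * csqrt (q y a))) * (w - a))
           \<le> 4 * B * norm (w - a) ^ 2"
          by (simp only: mult.assoc mult.left_commute[of B 4])
        have "e y / csqrt (q y w) - e y / csqrt (q y a) - d y * (w - a)
            = e y * (1 / csqrt (q y w) - 1 / csqrt (q y a) - (-1 / (q y a * csqrt (q y a))) * (w - a))"
          by (simp add: d_def ring_distribs)
        also have "norm \<dots> \<le> exp (- (y\<^sup>2)) * (4 * B * norm (w - a) ^ 2)"
          unfolding norm_mult[of "e y"] using n by (intro mult_mono) (auto simp: e_def)
        finally show ?thesis by (simp add: mult_ac)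
      qed
      have "norm (LBINT y:{0<..}. e y / csqrt (q y w) - e y / csqrt (q y a) - d y * (w - a))
          \<le> (LBINT y:{0<..}. 4 * B * norm (w - a) ^ 2 * exp (- (y\<^sup>2)))"
        by (intro norm_set_integral_le bd set_integral_diff set_integrable_mult_left set_integrable_mult_right
             int intd elim da set_integrable_gaussian)
      then show ?case
        unfolding eq by (simp add: mult_ac)
    qed
  qed
  then have "((\<lambda>w. 2 * exp (- w) * G w) has_field_derivative
     2 * exp (- a) * (LBINT y:{0<..}. d y) + - (2 * exp (- a)) * G a) (at a)"
    by (auto intro!: derivative_eq_intros)
  moreover have "(\<lambda>w. 2 * exp (- w) * G w) = Macdonald"
    by (simp add: fun_eq_iff Macdonald_def G_def e_def q_def)
  ultimately show ?thesis by auto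
qed

lemma Macdonald_holomorphic: "Macdonald holomorphic_on {w. Im w < Re w}"
proof -
  have "Macdonald field_differentiable at w" if "Im w < Re w" for w
    using Macdonald_has_derivative[OF that] by (auto simp: field_differentiable_def)
  then show ?thesis
    by (auto simp: holomorphic_on_def intro: field_differentiable_at_within)
qed

text \<open>For \<open>Re w \<ge> 0\<close> the modulus \<open>q\<close> of \<open>y\<^sup>2 + 2 * w\<close> is at least \<open>y\<^sup>2\<close> and at least \<open>\<bar>w\<bar>\<close>, hence at
  least \<open>(y\<^sup>2) powr (1 - a) * \<bar>w\<bar> powr a\<close>. The choice \<open>a = 1\<close> gives the decay at infinity, while
  a small \<open>a\<close> gives a small negative power in place of the true logarithmic growth at the origin.\<close>

lemma norm_Macdonald_le:
  assumes a: "0 < a" "a \<le> 1" and w: "0 \<le> Re w" "Im w < Re w"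
  shows "norm (Macdonald w) \<le>
    4 * (LBINT y:{0<..}. y powr (a - 1) * exp (- y)) * exp (- Re w) * norm w powr (- a / 2)"
proof -
  let ?q = "\<lambda>y. of_real (y\<^sup>2) + 2 * w"
  have w0: "w \<noteq> 0" using w by auto
  have "norm (LBINT y:{0<..}. of_real (exp (- (y\<^sup>2))) / csqrt (?q y))
      \<le> (LBINT y:{0<..}. 2 * norm w powr (- a / 2) * (y powr (a - 1) * exp (- y)))"
  proof (rule norm_set_integral_le)
    show "set_integrable lborel {0<..} (\<lambda>y. of_real (exp (- (y\<^sup>2))) / csqrt (?q y))"
      by (intro set_integrable_Macdonald w)
    show "set_integrable lborel {0<..} (\<lambda>y. 2 * norm w powr (- a / 2) * (y powr (a - 1) * exp (- y)))"
      using set_integrable_powr_exp[of a 1] a by (intro set_integrable_mult_right) simp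
    fix y :: real assume "y \<in> {0<..}"
    then have y: "y > 0" by simp
    define m where "m = norm (?q y)"
    have "y\<^sup>2 \<le> Re (?q y)" using w by (simp flip: of_real_power)
    then have m1: "y\<^sup>2 \<le> m"
      unfolding m_def using complex_Re_le_cmod order_trans by blast
    have "(norm w)\<^sup>2 \<le> m\<^sup>2"
    proof -
      have "m\<^sup>2 = (y\<^sup>2 + 2 * Re w)\<^sup>2 + (2 * Im w)\<^sup>2"
        unfolding m_def cmod_power2 by (simp flip: of_real_power)
      moreover have "(Re w)\<^sup>2 \<le> (y\<^sup>2 + 2 * Re w)\<^sup>2"
        using w by (intro power_mono) auto
      ultimately show ?thesis
        unfolding cmod_power2[of w] by (simp add: power_mult_distrib add_mono)
    qed
    then have m2: "norm w \<le> m"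
      by (rule power2_le_imp_le) (simp add: m_def)
    \<comment> \<open>split \<open>1 / sqrt m\<close> into two powers and bound one by each of the two lower bounds\<close>
    have m0: "m > 0" using m2 w0 by (meson less_le_trans zero_less_norm_iff)
    have "1 / sqrt m = m powr (-1/2)"
      using m0 by (simp add: powr_minus_divide powr_half_sqrt)
    also have "\<dots> = m powr (- (1 - a) / 2) * m powr (- a / 2)"
      by (simp add: diff_divide_distrib flip: powr_add)
    also have "\<dots> \<le> (y\<^sup>2) powr (- (1 - a) / 2) * norm w powr (- a / 2)"
      using m1 m2 y w0 a by (intro mult_mono powr_mono2') auto
    also have "(y\<^sup>2) powr (- (1 - a) / 2) = y powr (a - 1)"
      using y by (simp add: powr_powr diff_divide_distrib flip: powr_numeral)
    finally have le: "1 / sqrt m \<le> y powr (a - 1) * norm w powr (- a / 2)" .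
    have "norm (of_real (exp (- (y\<^sup>2))) / csqrt (?q y)) = exp (- (y\<^sup>2)) * (1 / sqrt m)"
      by (simp add: norm_divide m_def)
    also have "\<dots> \<le> (2 * exp (- y)) * (y powr (a - 1) * norm w powr (- a / 2))"
      using m0 by (intro mult_mono gaussian_le_exp le) auto
    finally show "norm (of_real (exp (- (y\<^sup>2))) / csqrt (?q y)) \<le> 2 * norm w powr (- a / 2) * (y powr (a - 1) * exp (- y))"
      by (simp add: mult_ac)
  qed
  also have "\<dots> = 2 * norm w powr (- a / 2) * (LBINT y:{0<..}. y powr (a - 1) * exp (- y))"
    by (rule set_integral_mult_right)
  finally have "norm (Macdonald w) \<le> 2 * exp (- Re w) * (2 * norm w powr (- a / 2) * (LBINT y:{0<..}. y powr (a - 1) * exp (- y)))"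
    unfolding Macdonald_def norm_mult by (intro mult_mono) auto
  then show ?thesis by (simp add: mult_ac)
qed

lemma le_sinh_real: "0 \<le> x \<Longrightarrow> x \<le> sinh (x::real)"
  using real_le_x_sinh[of x] by (simp add: sinh_def exp_minus)

lemma le_cosh_real:
  assumes "0 \<le> x"
  shows "x + 1 / 2 \<le> cosh (x::real)"
proof -
  have "(x / 2)\<^sup>2 \<le> (sinh (x / 2))\<^sup>2"
    using assms by (intro power_mono le_sinh_real) auto
  moreover have "cosh x = 1 + 2 * (sinh (x / 2))\<^sup>2"
    using cosh_double[of "x / 2"] by (simp add: cosh_square_eq)
  moreover have "0 \<le> (x - 1)\<^sup>2" by simp
  ultimately show ?thesis by (simp add: power2_diff power_divide)
qed

text \<open>Linear growth of \<open>(sinh a)\<^sup>2 / cosh a = cosh a - 1 / cosh a\<close>, the exponent of decay along the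
  curve \<open>u = a + \<i> * arctan (sinh a)\<close>.\<close>

lemma saddle_exponent_ge:
  assumes "0 \<le> a"
  shows "a - 1 \<le> (sinh a)\<^sup>2 / cosh (a::real)"
proof -
  have "(sinh a)\<^sup>2 / cosh a = cosh a - 1 / cosh a"
    using cosh_square_eq[of a] by (simp add: field_simps power2_eq_square)
  moreover have "1 / cosh a \<le> 1" using cosh_real_ge_1[of a] by (simp add: divide_le_eq)
  ultimately show ?thesis using le_cosh_real[OF assms] by linarith
qed

lemma set_integrable_exp_cosh:
  assumes "t > 0"
  shows "set_integrable lborel {0<..} (\<lambda>u::real. exp (- t * cosh u))"
proof (rule set_integrable_continuous_bound)
  show "set_integrable lborel {0<..} (\<lambda>u. exp (- (t * u)))"
    using assms by (rule set_integrable_exp)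
  fix u :: real
  assume "u > 0"
  then have "u \<le> cosh u" using le_cosh_real[of u] by simp
  then show "norm (exp (- t * cosh u)) \<le> exp (- (t * u))"
    using assms by simp
qed (auto intro!: continuous_intros)

lemma einterval_half_line: "einterval 0 \<infinity> = {0<..}"
  by (auto simp: einterval_def zero_ereal_def)

lemma LBINT_half_line: "(LBINT x=0..\<infinity>. f x) = (LBINT x:{0<..}. f x)"
  by (simp add: interval_lebesgue_integral_def einterval_half_line)

text \<open>The interval integrals with extended real endpoints, specialised to the half-line.\<close>

lemma half_line_FTC:
  fixes f F :: "real \<Rightarrow> 'a::euclidean_space"
  assumes "\<And>x. x > 0 \<Longrightarrow> (F has_vector_derivative f x) (at x)"
    and "\<And>x. x > 0 \<Longrightarrow> isCont f x"
    and "set_integrable lborel {0<..} f"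
    and "(F \<longlongrightarrow> A) (at_right 0)" "(F \<longlongrightarrow> B) at_top"
  shows "(LBINT x:{0<..}. f x) = B - A"
proof -
  have "(LBINT x=0..\<infinity>. f x) = B - A"
  proof (rule interval_integral_FTC_integrable)
    show "((F \<circ> real_of_ereal) \<longlongrightarrow> A) (at_right 0)" "((F \<circ> real_of_ereal) \<longlongrightarrow> B) (at_left \<infinity>)"
      using assms(4,5) by (simp_all add: zero_ereal_def ereal_tendsto_simps)
  qed (use assms in \<open>auto simp: einterval_half_line zero_ereal_def\<close>)
  then show ?thesis by (simp only: LBINT_half_line)
qed

lemma half_line_substitution:
  fixes f :: "real \<Rightarrow> 'a::euclidean_space"
  assumes "\<And>u. (g has_real_derivative g' u) (at u)"
    and "\<And>u. isCont f (g u)" "\<And>u. isCont g' u" "\<And>u. 0 \<le> g' u"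
    and "g 0 = 0" "filterlim g at_top at_top"
    and "set_integrable lborel {0<..} (\<lambda>u. g' u *\<^sub>R f (g u))" "set_integrable lborel {0<..} f"
  shows "(LBINT y:{0<..}. f y) = (LBINT u:{0<..}. g' u *\<^sub>R f (g u))"
proof -
  have "isCont g 0" using assms(1)[of 0] by (rule DERIV_isCont)
  then have "(g \<longlongrightarrow> 0) (at_right 0)"
    using assms(5) by (simp add: isCont_def filterlim_at_split)
  then have 0: "((ereal \<circ> g \<circ> real_of_ereal) \<longlongrightarrow> 0) (at_right 0)"
    by (simp add: zero_ereal_def ereal_tendsto_simps)
  have 1: "((ereal \<circ> g \<circ> real_of_ereal) \<longlongrightarrow> \<infinity>) (at_left \<infinity>)"
    using assms(6) by (simp add: ereal_tendsto_simps)
  have "(LBINT y=0..\<infinity>. f y) = (LBINT u=0..\<infinity>. g' u *\<^sub>R f (g u))"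
    using assms by (intro interval_integral_substitution_integrable 0 1) (auto simp: einterval_half_line)
  then show ?thesis by (simp only: LBINT_half_line)
qed

lemma set_integrable_of_real:
  "set_integrable M A f \<Longrightarrow> set_integrable M A (\<lambda>x. complex_of_real (f x))"
  unfolding set_integrable_def by (simp add: scaleR_conv_of_real flip: of_real_mult)

lemma Macdonald_of_real:
  assumes t: "t > 0"
  shows "Macdonald (of_real t) = of_real (K0 t)"
proof -
  define f where "f y = of_real (exp (- (y\<^sup>2))) / csqrt (of_real (y\<^sup>2) + 2 * of_real t)" for y
  define g where "g u = sqrt (2 * t) * sinh (u / 2)" for u
  define g' where "g' u = sqrt (2 * t) * cosh (u / 2) / 2" for u
  have fg: "g' u *\<^sub>R f (g u) = of_real (exp t / 2 * exp (- t * cosh u))" for u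
  proof -
    have "(g u)\<^sup>2 + 2 * t = 2 * t * ((sinh (u / 2))\<^sup>2 + 1)"
      using t by (simp add: g_def power_mult_distrib algebra_simps)
    also have "\<dots> = 2 * t * (cosh (u / 2))\<^sup>2"
      by (simp add: cosh_square_eq)
    also have "\<dots> = (2 * g' u)\<^sup>2"
      using t by (simp add: g'_def power_mult_distrib)
    finally have "of_real ((g u)\<^sup>2) + 2 * of_real t = (complex_of_real (2 * g' u))\<^sup>2"
      by (metis of_real_add of_real_mult of_real_numeral of_real_power)
    moreover have gpos: "g' u > 0" using t by (simp add: g'_def)
    ultimately have "csqrt (of_real ((g u)\<^sup>2) + 2 * of_real t) = complex_of_real (2 * g' u)"
      by (simp only:) (rule csqrt_square, simp)
    moreover have "- ((g u)\<^sup>2) = t - t * cosh u"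
      using t cosh_double[of "u / 2"] by (simp add: g_def power_mult_distrib cosh_square_eq algebra_simps)
    ultimately have "f (g u) = of_real (exp (t - t * cosh u)) / of_real (2 * g' u)"
      by (simp only: f_def)
    then show ?thesis
      using gpos by (simp add: exp_diff exp_minus scaleR_conv_of_real field_simps)
  qed
  have "(LBINT y:{0<..}. f y) = (LBINT u:{0<..}. g' u *\<^sub>R f (g u))"
  proof (rule half_line_substitution)
    show "DERIV g x :> g' x" for x
      unfolding g_def g'_def by (auto intro!: derivative_eq_intros)
    show "isCont f (g x)" for x
      unfolding f_def by (rule isCont_Macdonald_integrand) (use t in simp)
    show "isCont g' x" for x
      unfolding g'_def by (intro continuous_intros) auto
    show "g' x \<ge> 0" for x using t by (simp add: g'_def)
    show "g 0 = 0" by (simp add: g_def)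
    show "filterlim g at_top at_top"
      using t unfolding g_def by real_asymp
    show "set_integrable lborel {0<..} (\<lambda>u. g' u *\<^sub>R f (g u))"
      unfolding fg
      by (intro set_integrable_of_real set_integrable_mult_right set_integrable_exp_cosh t)
    show "set_integrable lborel {0<..} f"
      unfolding f_def by (rule set_integrable_Macdonald) (use t in simp)
  qed
  also have "\<dots> = of_real (exp t / 2 * K0 t)"
    unfolding fg set_integral_complex_of_real by (simp add: K0_def)
  finally have "Macdonald (of_real t) = 2 * exp (- of_real t) * of_real (exp t / 2 * K0 t)"
    unfolding Macdonald_def f_def by (simp only:)
  then show ?thesis
    by (simp add: exp_of_real exp_minus)
qed

section \<open>The connection between \<open>K0\<close> on the imaginary axis and \<open>J0\<close>\<close>

lemma cosh_of_real: "cosh (complex_of_real x) = of_real (cosh x)"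
  by (simp add: cosh_def exp_of_real scaleR_conv_of_real flip: of_real_minus)

lemma sinh_of_real: "sinh (complex_of_real x) = of_real (sinh x)"
  by (simp add: sinh_def exp_of_real scaleR_conv_of_real flip: of_real_minus)

lemma cosh_of_real_plus_i_of_real:
  "cosh (of_real a + \<i> * of_real b) = of_real (cosh a * cos b) + \<i> * of_real (sinh a * sin b)"
  unfolding cosh_add by (simp only: cosh_conv_cos[of "\<i> * of_real b"] sinh_conv_sin[of "\<i> * of_real b"] cosh_of_real sinh_of_real)
    (simp add: cos_of_real sin_of_real flip: mult.assoc)

text \<open>The steepest descent curve through the saddle point \<open>u = 0\<close> of \<open>cosh\<close>: the exponent
  \<open>\<i> * t * cosh u\<close> has constant imaginary part \<open>t\<close> along it.\<close>

lemma cosh_saddle_curve: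
  "cosh (of_real a + \<i> * of_real (arctan (sinh a))) = 1 + \<i> * of_real ((sinh a)\<^sup>2 / cosh a)"
proof -
  have s: "sqrt (1 + (sinh a)\<^sup>2) = cosh a"
    using cosh_square_eq[of a] by (simp add: real_sqrt_unique)
  then show ?thesis
    unfolding cosh_of_real_plus_i_of_real cos_arctan sin_arctan s
    by (simp add: power2_eq_square)
qed

text \<open>Along the segment from \<open>0\<close> to \<open>\<i> * pi\<close> a primitive of \<open>exp (\<i> * t * cosh u)\<close> produces Poisson's
  integral. The real part of its integrand is symmetric about \<open>pi / 2\<close>, so half of the segment gives half
  of that part.\<close>

lemma integral_quarter_period:
  assumes \<Phi>: "\<And>u. (\<Phi> has_field_derivative exp (\<i> * of_real t * cosh u)) (at u)"
  shows "Im (\<Phi> (\<i> * of_real (pi / 2)) - \<Phi> 0) = pi / 2 * J0 t"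
proof -
  have d: "((\<lambda>\<theta>. \<Phi> (\<i> * of_real \<theta>)) has_vector_derivative \<i> * exp (\<i> * of_real t * of_real (cos \<theta>))) (at \<theta> within S)" for \<theta> S
  proof -
    have "((\<lambda>w. \<Phi> (\<i> * w)) has_field_derivative exp (\<i> * of_real t * cosh (\<i> * of_real \<theta>)) * \<i>) (at (of_real \<theta>))"
      by (rule DERIV_chain2[OF \<Phi>]) (auto intro!: derivative_eq_intros)
    from has_vector_derivative_real_field[OF this] show ?thesis
      by (simp add: cosh_conv_cos cos_of_real mult.commute)
  qed
  define c where "c \<theta> = Im (\<Phi> (\<i> * of_real \<theta>))" for \<theta>
  have dc: "(c has_real_derivative cos (t * cos \<theta>)) (at \<theta> within S)" for \<theta> S
  proof -
    have "(c has_vector_derivative Im (\<i> * exp (\<i> * of_real t * of_real (cos \<theta>)))) (at \<theta> within S)"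
      unfolding c_def by (rule bounded_linear.has_vector_derivative[OF bounded_linear_Im d])
    then show ?thesis
      by (simp add: has_real_derivative_iff_has_vector_derivative Re_exp)
  qed
  have "((\<lambda>\<theta>. c (pi - \<theta>) + c \<theta>) has_real_derivative 0) (at \<theta>)" for \<theta>
  proof -
    have "((\<lambda>\<theta>. c (pi - \<theta>) + c \<theta>) has_real_derivative cos (t * cos (pi - \<theta>)) * (-1) + cos (t * cos \<theta>)) (at \<theta>)"
      by (intro DERIV_add dc DERIV_chain2[OF dc]) (auto intro!: derivative_eq_intros)
    then show ?thesis by simp
  qed
  then have "c (pi - 0) + c 0 = c (pi - pi / 2) + c (pi / 2)"
    using DERIV_isconst_all[of "\<lambda>\<theta>. c (pi - \<theta>) + c \<theta>" 0 "pi / 2"] by blast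
  then have 1: "c (pi / 2) - c 0 = (c pi - c 0) / 2" by (simp add: field_simps)
  have "((\<lambda>\<theta>. \<i> * exp (\<i> * of_real t * of_real (cos \<theta>))) has_integral
      \<Phi> (\<i> * of_real pi) - \<Phi> (\<i> * of_real 0)) {0..pi}"
    by (rule fundamental_theorem_of_calculus) (auto intro!: d)
  then have "\<Phi> (\<i> * of_real pi) - \<Phi> (\<i> * of_real 0) = \<i> * integral {0..pi} (\<lambda>\<theta>. exp (\<i> * of_real t * of_real (cos \<theta>)))"
    by (simp add: has_integral_iff)
  also have "\<dots> = \<i> * of_real (pi * J0 t)"
    using Bessel_J_Poisson_integral[of "of_real t"] by (simp add: Bessel_J_of_real field_simps)
  finally have "Im (\<Phi> (\<i> * of_real pi) - \<Phi> (\<i> * of_real 0)) = pi * J0 t" by simp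
  with 1 show ?thesis by (simp add: c_def)
qed

text \<open>The vertical segment between the curve and the line \<open>Im u = pi / 2\<close> contributes nothing in the
  limit: on it \<open>exp (\<i> * t * cosh u)\<close> is largest at the end on the curve, where it is
  exponentially small.\<close>

lemma saddle_curve_limit:
  assumes t: "t > 0" and \<Phi>: "\<And>u. (\<Phi> has_field_derivative exp (\<i> * of_real t * cosh u)) (at u)"
  shows "((\<lambda>a. \<Phi> (of_real a + \<i> * of_real (arctan (sinh a))) - \<Phi> (of_real a + \<i> * of_real (pi / 2))) \<longlongrightarrow> 0) at_top"
proof (rule Lim_null_comparison)
  show "\<forall>\<^sub>F a in at_top. norm (\<Phi> (of_real a + \<i> * of_real (arctan (sinh a))) - \<Phi> (of_real a + \<i> * of_real (pi / 2)))
     \<le> pi / 2 * exp (- (t * (a - 1)))"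
    using eventually_ge_at_top[of 0]
  proof eventually_elim
    case (elim a)
    let ?g = "arctan (sinh a)" let ?h = "\<lambda>\<beta>. complex_of_real a + \<i> * of_real \<beta>"
    have g: "0 \<le> ?g" "?g < pi / 2" using elim arctan_ubound by auto
    have "norm (\<Phi> (?h ?g) - \<Phi> (?h (pi / 2))) \<le> exp (- (t * (a - 1))) * norm (?h ?g - ?h (pi / 2))"
    proof (rule field_differentiable_bound)
      show "convex (closed_segment (?h ?g) (?h (pi / 2)))" by simp
      fix u assume u: "u \<in> closed_segment (?h ?g) (?h (pi / 2))"
      show "(\<Phi> has_field_derivative exp (\<i> * of_real t * cosh u)) (at u within closed_segment (?h ?g) (?h (pi / 2)))"
        using \<Phi> has_field_derivative_at_within by blast
      obtain r where r: "0 \<le> r" "r \<le> 1" "u = (1 - r) *\<^sub>R ?h ?g + r *\<^sub>R ?h (pi / 2)"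
        using u by (auto simp: in_segment)
      define \<beta> where "\<beta> = (1 - r) * ?g + r * (pi / 2)"
      have ub: "u = ?h \<beta>" using r by (simp add: \<beta>_def scaleR_conv_of_real algebra_simps)
      have b: "?g \<le> \<beta>" "\<beta> \<le> pi / 2"
      proof -
        have "r * ?g \<le> r * (pi / 2)" "(1 - r) * ?g \<le> (1 - r) * (pi / 2)"
          using r g by (auto intro!: mult_left_mono simp del: times_divide_eq_right)
        then show "?g \<le> \<beta>" "\<beta> \<le> pi / 2" unfolding \<beta>_def by (auto simp: algebra_simps)
      qed
      have "sinh a / cosh a = sin ?g"
        using cosh_square_eq[of a] by (simp add: sin_arctan real_sqrt_unique add.commute)
      also have "\<dots> \<le> sin \<beta>"
        using b g pi_gt_zero by (intro sin_monotone_2pi_le) linarith+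
      finally have "sinh a * (sinh a / cosh a) \<le> sinh a * sin \<beta>"
        using elim by (intro mult_left_mono) auto
      moreover have "a - 1 \<le> sinh a * (sinh a / cosh a)"
        using saddle_exponent_ge[OF elim] by (simp add: power2_eq_square)
      moreover have "Re (\<i> * of_real t * cosh u) = - (t * (sinh a * sin \<beta>))"
        unfolding ub cosh_of_real_plus_i_of_real by simp
      ultimately show "norm (exp (\<i> * of_real t * cosh u)) \<le> exp (- (t * (a - 1)))"
        using t by (simp add: norm_exp_eq_Re)
    qed auto
    also have "\<dots> \<le> exp (- (t * (a - 1))) * (pi / 2)"
    proof -
      have "?h ?g - ?h (pi / 2) = \<i> * of_real (?g - pi / 2)" by (simp add: algebra_simps)
      then have "norm (?h ?g - ?h (pi / 2)) = \<bar>?g - pi / 2\<bar>"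
        by (simp only: norm_mult norm_ii norm_of_real) simp
      then show ?thesis using g by (intro mult_left_mono) auto
    qed
    finally show ?case by (simp add: mult.commute)
  qed
  show "((\<lambda>a. pi / 2 * exp (- (t * (a - 1)))) \<longlongrightarrow> 0) at_top"
    using t by real_asymp
qed

text \<open>The form \<open>exp (\<i> * t * cosh u) du\<close> pulled back to the curve \<open>u = a + \<i> * arctan (sinh a)\<close>.\<close>

definition saddle_integrand :: "real \<Rightarrow> real \<Rightarrow> complex" where
  "saddle_integrand t a = exp (\<i> * of_real t * (1 + \<i> * of_real ((sinh a)\<^sup>2 / cosh a))) * (1 + \<i> / of_real (cosh a))"

lemma isCont_saddle_integrand: "isCont (saddle_integrand t) a"
  unfolding saddle_integrand_def by (intro continuous_intros) auto

lemma set_integrable_saddle_integrand: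
  assumes "t > 0"
  shows "set_integrable lborel {0<..} (saddle_integrand t)"
proof (rule set_integrable_continuous_bound)
  show "continuous_on {0<..} (saddle_integrand t)"
    by (intro continuous_at_imp_continuous_on ballI isCont_saddle_integrand)
  show "set_integrable lborel {0<..} (\<lambda>a. 2 * exp t * exp (- (t * a)))"
    using assms by (intro set_integrable_mult_right set_integrable_exp)
  fix a :: real assume a: "a > 0"
  have "norm (saddle_integrand t a) = exp (- (t * ((sinh a)\<^sup>2 / cosh a))) * norm (1 + \<i> / of_real (cosh a))"
    by (simp add: saddle_integrand_def norm_mult)
  also have "\<dots> \<le> exp (- (t * (a - 1))) * 2"
  proof (intro mult_mono)
    show "exp (- (t * ((sinh a)\<^sup>2 / cosh a))) \<le> exp (- (t * (a - 1)))"
      using saddle_exponent_ge[of a] a assms by (simp add: mult_left_mono del: times_divide_eq_right)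
    have "norm (\<i> / complex_of_real (cosh a)) \<le> 1"
      using cosh_real_ge_1[of a] by (simp add: norm_divide divide_le_eq)
    then show "norm (1 + \<i> / of_real (cosh a)) \<le> 2"
      using norm_triangle_ineq[of 1 "\<i> / of_real (cosh a)"] by simp
  qed auto
  finally show "norm (saddle_integrand t a) \<le> 2 * exp t * exp (- (t * a))"
    by (simp add: right_diff_distrib exp_diff exp_minus field_simps)
qed

text \<open>The parameter \<open>y\<close> of the defining integral and the parameter \<open>a\<close> of the curve are related by
  \<open>cosh u = 1 + y\<^sup>2 / w\<close> with \<open>w = - \<i> * t\<close>, that is \<open>y\<^sup>2 = t * (sinh a)\<^sup>2 / cosh a\<close>. The square root becomes
  rational because \<open>y\<^sup>2 - 2 * \<i> * t = t / cosh a * (cosh a - \<i>)\<^sup>2\<close>.\<close>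

lemma Macdonald_eq_saddle_integral:
  assumes t: "t > 0"
  shows "Macdonald (- \<i> * of_real t) = (LBINT a:{0<..}. saddle_integrand t a)"
proof -
  define f where "f y = of_real (exp (- (y\<^sup>2))) / csqrt (of_real (y\<^sup>2) + 2 * (- \<i> * of_real t))" for y
  define g where "g a = sqrt t * sinh a / sqrt (cosh a)" for a
  define g' where "g' a = sqrt t * ((cosh a)\<^sup>2 + 1) / (2 * cosh a * sqrt (cosh a))" for a
  have w: "Im (- \<i> * of_real t) < Re (- \<i> * of_real t)" using t by simp
  have fg: "g' a *\<^sub>R f (g a) = exp (- \<i> * of_real t) / 2 * saddle_integrand t a" for a
  proof -
    define c where "c = cosh a"
    define p where "p = sqrt (t / c)"
    have c: "c > 0" and p: "p > 0" and p2: "p\<^sup>2 = t / c" using t by (auto simp: c_def p_def)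
    have g2: "(g a)\<^sup>2 = t * (sinh a)\<^sup>2 / c"
      using t by (simp add: g_def c_def power_divide power_mult_distrib)
    have "of_real ((g a)\<^sup>2) + 2 * (- \<i> * of_real t) = (of_real p * (of_real c - \<i>))\<^sup>2"
    proof -
      have "(sinh a)\<^sup>2 = c\<^sup>2 - 1" by (simp add: c_def cosh_square_eq)
      then have "(g a)\<^sup>2 = p\<^sup>2 * (c\<^sup>2 - 1)" by (simp add: g2 p2)
      moreover have "t = p\<^sup>2 * c" using c by (simp add: p2)
      ultimately have "of_real ((g a)\<^sup>2) + 2 * (- \<i> * of_real t) =
          complex_of_real (p\<^sup>2 * (c\<^sup>2 - 1)) + 2 * (- \<i> * of_real (p\<^sup>2 * c))"
        by (simp only:)
      also have "\<dots> = (of_real p * (of_real c - \<i>))\<^sup>2"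
        by (simp add: power2_eq_square algebra_simps)
      finally show ?thesis .
    qed
    then have "csqrt (of_real ((g a)\<^sup>2) + 2 * (- \<i> * of_real t)) = of_real p * (of_real c - \<i>)"
      using c p by (simp only:) (rule csqrt_square, simp)
    then have f: "f (g a) = of_real (exp (- (t * ((sinh a)\<^sup>2 / c)))) / (of_real p * (of_real c - \<i>))"
      by (simp only: f_def g2) simp
    have "g' a = p * (c\<^sup>2 + 1) / (2 * c)"
      using c by (simp add: g'_def p_def c_def real_sqrt_divide)
    moreover have "complex_of_real (c\<^sup>2 + 1) = (of_real c - \<i>) * (of_real c + \<i>)"
      by (simp add: algebra_simps power2_eq_square)
    moreover have "complex_of_real c - \<i> \<noteq> 0" by (simp add: complex_eq_iff)
    ultimately have "g' a *\<^sub>R f (g a) = of_real (exp (- (t * ((sinh a)\<^sup>2 / c)))) / 2 * ((of_real c + \<i>) / of_real c)"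
      using p c unfolding f by (simp add: scaleR_conv_of_real)
    also have "(of_real c + \<i>) / of_real c = 1 + \<i> / of_real c"
      using c by (simp add: add_divide_distrib)
    also have "of_real (exp (- (t * ((sinh a)\<^sup>2 / c)))) =
        exp (- \<i> * of_real t) * exp (\<i> * of_real t * (1 + \<i> * of_real ((sinh a)\<^sup>2 / c)))"
    proof -
      have "of_real (- (t * ((sinh a)\<^sup>2 / c))) =
          - \<i> * of_real t + \<i> * of_real t * (1 + \<i> * of_real ((sinh a)\<^sup>2 / c))"
        by (simp add: complex_eq_iff)
      then show ?thesis
        by (simp only: exp_of_real[symmetric] exp_add[symmetric])
    qed
    finally show ?thesis
      by (simp add: saddle_integrand_def c_def)
  qed
  have "(LBINT y:{0<..}. f y) = (LBINT u:{0<..}. g' u *\<^sub>R f (g u))"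
  proof (rule half_line_substitution)
    fix a :: real
    define q where "q = sqrt (cosh a)"
    have q: "q > 0" "cosh a = q\<^sup>2" "sqrt (cosh a) = q" by (simp_all add: q_def)
    have "DERIV g a :> (sqrt t * cosh a * sqrt (cosh a) - sqrt t * sinh a * (sinh a / (2 * sqrt (cosh a)))) / (sqrt (cosh a) * sqrt (cosh a))"
    proof -
      have "((\<lambda>a. sqrt (cosh a)) has_real_derivative sinh a / (2 * sqrt (cosh a))) (at a)"
        using DERIV_chain2[OF DERIV_real_sqrt has_field_derivative_cosh[OF DERIV_ident]] by (simp add: field_simps)
      moreover have "((\<lambda>a. sqrt t * sinh a) has_real_derivative sqrt t * cosh a) (at a)"
        by (auto intro!: derivative_eq_intros)
      ultimately show ?thesis
        unfolding g_def by (intro DERIV_divide) auto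
    qed
    also have "sqrt t * cosh a * sqrt (cosh a) - sqrt t * sinh a * (sinh a / (2 * sqrt (cosh a)))
       = sqrt t * (cosh a * sqrt (cosh a) - ((cosh a)\<^sup>2 - 1) / (2 * sqrt (cosh a)))"
      unfolding cosh_square_eq by (simp add: power2_eq_square algebra_simps)
    also have "\<dots> / (sqrt (cosh a) * sqrt (cosh a)) = g' a"
      unfolding g'_def q(3) unfolding q(2) using q(1)
      by (simp add: field_simps power2_eq_square)
    finally show "DERIV g a :> g' a" .
    show "isCont f (g a)"
      unfolding f_def by (rule isCont_Macdonald_integrand[OF w])
    show "isCont g' a"
      unfolding g'_def by (intro continuous_intros) auto
    show "g' a \<ge> 0" using t by (simp add: g'_def)
  next
    show "g 0 = 0" by (simp add: g_def)
    show "filterlim g at_top at_top"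
      using t unfolding g_def by real_asymp
    show "set_integrable lborel {0<..} (\<lambda>u. g' u *\<^sub>R f (g u))"
      unfolding fg
      by (intro set_integrable_mult_right set_integrable_saddle_integrand t)
    show "set_integrable lborel {0<..} f"
      unfolding f_def by (rule set_integrable_Macdonald[OF w])
  qed
  also have "\<dots> = exp (- \<i> * of_real t) / 2 * (LBINT a:{0<..}. saddle_integrand t a)"
    unfolding fg by (rule set_integral_mult_right)
  finally have "Macdonald (- \<i> * of_real t) = 2 * exp (- (- \<i> * of_real t)) *
      (exp (- \<i> * of_real t) / 2 * (LBINT a:{0<..}. saddle_integrand t a))"
    unfolding Macdonald_def f_def by (simp only:)
  then show ?thesis
    by (simp add: exp_minus)
qed

text \<open>The curve runs from \<open>0\<close> and approaches the line \<open>Im u = pi / 2\<close>. By the existence of a primitive, the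
  integral along it is the one along the segment from \<open>0\<close> to \<open>\<i> * pi / 2\<close> followed by that line, and on the
  line \<open>\<i> * t * cosh u = - t * sinh a\<close> is real.\<close>

lemma Im_Macdonald_imaginary:
  assumes t: "t > 0"
  shows "Im (Macdonald (- \<i> * of_real t)) = pi / 2 * J0 t"
proof -
  obtain \<Phi> where "\<And>u. u \<in> UNIV \<Longrightarrow> (\<Phi> has_field_derivative exp (\<i> * of_real t * cosh u)) (at u within UNIV)"
    by (rule holomorphic_convex_primitive'[of UNIV "\<lambda>u. exp (\<i> * of_real t * cosh u)"])
       (auto simp: cosh_field_def intro!: holomorphic_intros)
  then have \<Phi>: "(\<Phi> has_field_derivative exp (\<i> * of_real t * cosh u)) (at u)" for u
    by simp
  define D where "D a = \<Phi> (of_real a + \<i> * of_real (arctan (sinh a))) - \<Phi> (of_real a + \<i> * of_real (pi / 2))" for a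
  have int: "set_integrable lborel {0<..} (\<lambda>a. complex_of_real (exp (- t * sinh a)))"
  proof (rule set_integrable_of_real, rule set_integrable_continuous_bound)
    show "set_integrable lborel {0<..} (\<lambda>u. exp (- (t * u)))"
      using t by (rule set_integrable_exp)
    show "norm (exp (- t * sinh u)) \<le> exp (- (t * u))" if "u > 0" for u :: real
      using t that le_sinh_real[of u] by simp
  qed (auto intro!: continuous_intros)
  have dD: "(D has_vector_derivative saddle_integrand t a - of_real (exp (- t * sinh a))) (at a)" for a
  proof -
    have "(sinh a)\<^sup>2 + 1 = (cosh a)\<^sup>2" by (simp add: cosh_square_eq)
    then have "inverse (1 + (sinh a)\<^sup>2) * cosh a = 1 / cosh a"
      by (simp add: add.commute power2_eq_square divide_inverse)
    moreover have "((\<lambda>a. arctan (sinh a)) has_real_derivative inverse (1 + (sinh a)\<^sup>2) * cosh a) (at a)"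
      by (rule DERIV_chain2[OF DERIV_arctan]) (auto intro!: derivative_eq_intros)
    ultimately have gd: "((\<lambda>a. arctan (sinh a)) has_real_derivative 1 / cosh a) (at a)"
      by (simp only:)
    have "((\<lambda>a. of_real a + \<i> * of_real (arctan (sinh a))) has_vector_derivative 1 + \<i> * of_real (1 / cosh a)) (at a)"
      by (intro has_vector_derivative_add has_vector_derivative_mult_right has_vector_derivative_of_real gd DERIV_ident)
         (auto intro!: derivative_eq_intros)
    from field_vector_diff_chain_at[OF this \<Phi>]
    have 1: "((\<lambda>a. \<Phi> (of_real a + \<i> * of_real (arctan (sinh a)))) has_vector_derivative saddle_integrand t a) (at a)"
      unfolding cosh_saddle_curve o_def saddle_integrand_def by (simp add: mult.commute)
    have "((\<lambda>a. of_real a + \<i> * of_real (pi / 2)) has_vector_derivative 1) (at a)"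
      by (auto intro!: derivative_eq_intros)
    note 2 = field_vector_diff_chain_at[OF this \<Phi>]
    have 2: "((\<lambda>a. \<Phi> (of_real a + \<i> * of_real (pi / 2))) has_vector_derivative of_real (exp (- t * sinh a))) (at a)"
    proof -
      have "\<i> * of_real t * cosh (of_real a + \<i> * of_real (pi / 2)) = of_real (- t * sinh a)"
        unfolding cosh_of_real_plus_i_of_real by (simp add: complex_eq_iff)
      then have "exp (\<i> * of_real t * cosh (of_real a + \<i> * of_real (pi / 2))) = of_real (exp (- t * sinh a))"
        by (simp only: exp_of_real)
      with 2 show ?thesis by (simp only: o_def mult_1)
    qed
    show ?thesis
      unfolding D_def by (intro has_vector_derivative_diff 1 2)
  qed
  have "(LBINT a:{0<..}. saddle_integrand t a - of_real (exp (- t * sinh a))) = 0 - D 0"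
  proof (rule half_line_FTC)
    show "(D has_vector_derivative saddle_integrand t a - of_real (exp (- t * sinh a))) (at a)" for a
      by (rule dD)
    show "isCont (\<lambda>a. saddle_integrand t a - of_real (exp (- t * sinh a))) a" for a
      by (intro continuous_intros isCont_saddle_integrand)
    show "set_integrable lborel {0<..} (\<lambda>a. saddle_integrand t a - of_real (exp (- t * sinh a)))"
      by (intro set_integral_diff set_integrable_saddle_integrand t int)
    have "isCont D 0" by (rule has_vector_derivative_continuous[OF dD])
    then show "(D \<longlongrightarrow> D 0) (at_right 0)"
      by (simp add: isCont_def filterlim_at_split)
    show "(D \<longlongrightarrow> 0) at_top"
      unfolding D_def using t \<Phi> by (rule saddle_curve_limit)
  qed
  also have "(LBINT a:{0<..}. saddle_integrand t a - of_real (exp (- t * sinh a))) =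
     Macdonald (- \<i> * of_real t) - of_real (LBINT a:{0<..}. exp (- t * sinh a))"
    by (simp only: set_integral_diff(2)[OF set_integrable_saddle_integrand[OF t] int]
         Macdonald_eq_saddle_integral[OF t] set_integral_complex_of_real)
  finally have "Macdonald (- \<i> * of_real t) =
      \<Phi> (\<i> * of_real (pi / 2)) - \<Phi> 0 + of_real (LBINT a:{0<..}. exp (- t * sinh a))"
    by (simp add: D_def algebra_simps)
  then show ?thesis
    using integral_quarter_period[OF \<Phi>] by simp
qed

section \<open>Rotation of an integral through the first quadrant\<close>

lemma set_integrable_inverse_1_plus_square:
  "set_integrable lborel {0<..} (\<lambda>t::real. 1 / (1 + t\<^sup>2))"
proof -
  have "set_integrable lborel (einterval 0 \<infinity>) (\<lambda>t::real. 1 / (1 + t\<^sup>2))"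
  proof (rule interval_integral_FTC_nonneg(1))
    show "DERIV arctan t :> 1 / (1 + t\<^sup>2)" for t
      by (auto intro!: derivative_eq_intros simp: divide_inverse)
    show "isCont (\<lambda>t::real. 1 / (1 + t\<^sup>2)) t" for t
      by (intro continuous_intros) (simp add: add_nonneg_eq_0_iff)
    have "(arctan \<longlongrightarrow> arctan 0) (at_right 0)"
      by (intro tendsto_intros)
    then show "((arctan \<circ> real_of_ereal) \<longlongrightarrow> 0) (at_right 0)"
      by (simp add: zero_ereal_def ereal_tendsto_simps)
    show "((arctan \<circ> real_of_ereal) \<longlongrightarrow> pi / 2) (at_left \<infinity>)"
      using tendsto_arctan_at_top by (simp add: ereal_tendsto_simps)
  qed auto
  then show ?thesis by (simp add: einterval_half_line)
qed

text \<open>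
  On the half-plane \<open>0 < Re z + Im z\<close> there is a primitive \<open>P\<close>, and \<open>P t - P (\<i> * t)\<close> tends to zero at
  both ends: the segment from \<open>\<i> * t\<close> to \<open>t\<close> has length at most \<open>2 * t\<close>, and on it the function is
  \<open>O (1 / (1 + t\<^sup>2))\<close>.
\<close>

lemma
  assumes hol: "f holomorphic_on {z. 0 < Re z + Im z}"
    and bound: "\<And>z. 0 \<le> Re z \<Longrightarrow> 0 \<le> Im z \<Longrightarrow> z \<noteq> 0 \<Longrightarrow> norm (f z) \<le> C / (1 + (norm z)\<^sup>2)"
  shows set_integrable_quadrant_real: "set_integrable lborel {0<..} (\<lambda>t. f (of_real t))"
    and set_integrable_quadrant_imaginary: "set_integrable lborel {0<..} (\<lambda>t. f (\<i> * of_real t))"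
    and quadrant_rotation: "(LBINT t:{0<..}. f (of_real t)) = \<i> * (LBINT t:{0<..}. f (\<i> * of_real t))"
proof -
  define U where "U = {z. 0 < Re z + Im z}"
  have "U = {z. z \<bullet> (1 + \<i>) > 0}"
    by (auto simp: U_def inner_complex_def)
  then have U: "convex U" "open U"
    using convex_halfspace_gt[of 0 "1 + \<i>"] open_halfspace_gt[of 0 "1 + \<i>"] by (auto simp: inner_commute)
  have "0 \<le> norm (f 1)" by simp
  also have "norm (f 1) \<le> C / 2" using bound[of 1] by simp
  finally have C: "0 \<le> C" by simp
  have iC: "isCont f z" if "z \<in> U" for z
    using hol U that holomorphic_on_imp_continuous_on[of f U] by (auto simp: U_def continuous_on_eq_continuous_at)
  have c1: "isCont (\<lambda>t. f (of_real t)) t" and c2: "isCont (\<lambda>t. f (\<i> * of_real t)) t" if "t > 0" for t :: real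
  proof -
    show "isCont (\<lambda>t. f (of_real t)) t"
      by (rule isCont_o2[OF _ iC]) (use that in \<open>auto simp: U_def\<close>)
    show "isCont (\<lambda>t. f (\<i> * of_real t)) t"
      by (rule isCont_o2[OF _ iC]) (use that in \<open>auto simp: U_def intro!: continuous_intros\<close>)
  qed
  have bnd: "set_integrable lborel {0<..} (\<lambda>t. C * (1 / (1 + t\<^sup>2)))"
    by (intro set_integrable_mult_right set_integrable_inverse_1_plus_square)
  show 1: "set_integrable lborel {0<..} (\<lambda>t. f (of_real t))"
  proof (rule set_integrable_continuous_bound[OF _ bnd])
    show "continuous_on {0<..} (\<lambda>t. f (of_real t))"
      by (intro continuous_at_imp_continuous_on ballI c1) simp
    show "norm (f (of_real t)) \<le> C * (1 / (1 + t\<^sup>2))" if "t > 0" for t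
      using bound[of "of_real t"] that by simp
  qed
  show 2: "set_integrable lborel {0<..} (\<lambda>t. f (\<i> * of_real t))"
  proof (rule set_integrable_continuous_bound[OF _ bnd])
    show "continuous_on {0<..} (\<lambda>t. f (\<i> * of_real t))"
      by (intro continuous_at_imp_continuous_on ballI c2) simp
    show "norm (f (\<i> * of_real t)) \<le> C * (1 / (1 + t\<^sup>2))" if "t > 0" for t
      using bound[of "\<i> * of_real t"] that by (simp add: norm_mult)
  qed
  obtain P where P: "\<And>z. z \<in> U \<Longrightarrow> (P has_field_derivative f z) (at z within U)"
    by (rule holomorphic_convex_primitive'[OF U hol[folded U_def]]) blast
  have P': "(P has_field_derivative f z) (at z)" if "z \<in> U" for z
    using P[OF that] unfolding at_within_open[OF that U(2)] .
  define D where "D t = P (of_real t) - P (\<i> * of_real t)" for t :: real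
  have nD: "norm (D t) \<le> C / (1 + t\<^sup>2 / 2) * (2 * t)" if t: "t > 0" for t
  proof -
    let ?S = "closed_segment (\<i> * of_real t) (of_real t)"
    have S: "0 \<le> Re u \<and> 0 \<le> Im u \<and> u \<noteq> 0 \<and> u \<in> U \<and> t\<^sup>2 / 2 \<le> (norm u)\<^sup>2" if "u \<in> ?S" for u
    proof -
      obtain r where r: "0 \<le> r" "r \<le> 1" "u = (1 - r) *\<^sub>R (\<i> * of_real t) + r *\<^sub>R of_real t"
        using \<open>u \<in> ?S\<close> by (auto simp: in_segment)
      then have u: "Re u = r * t" "Im u = (1 - r) * t" by auto
      \<comment> \<open>the midpoint of the segment is closest to the origin\<close>
      have "(norm u)\<^sup>2 - t\<^sup>2 / 2 = 2 * ((r - 1 / 2) * t)\<^sup>2"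
        unfolding cmod_power2 u by (simp add: power2_eq_square field_simps)
      then have 1: "t\<^sup>2 / 2 \<le> (norm u)\<^sup>2"
        using zero_le_power2[of "(r - 1 / 2) * t"] by linarith
      then have "u \<noteq> 0" using t by auto
      moreover have "Re u + Im u = t" by (simp add: u algebra_simps)
      moreover have "0 \<le> Re u" "0 \<le> Im u" using u r t by auto
      ultimately show ?thesis using 1 t by (simp add: U_def)
    qed
    have "norm (P (of_real t) - P (\<i> * of_real t)) \<le> C / (1 + t\<^sup>2 / 2) * norm (of_real t - \<i> * of_real t)"
    proof (rule field_differentiable_bound)
      show "convex ?S" by simp
      fix u assume u: "u \<in> ?S"
      show "(P has_field_derivative f u) (at u within ?S)"
        by (rule has_field_derivative_at_within[OF P']) (use S[OF u] in simp)
      have "C / (1 + (norm u)\<^sup>2) \<le> C / (1 + t\<^sup>2 / 2)"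
        using S[OF u] C by (intro divide_left_mono mult_pos_pos add_pos_nonneg) auto
      then show "norm (f u) \<le> C / (1 + t\<^sup>2 / 2)"
        using bound[of u] S[OF u] by linarith
    qed auto
    also have "\<dots> \<le> C / (1 + t\<^sup>2 / 2) * (2 * t)"
    proof (rule mult_left_mono)
      show "norm (complex_of_real t - \<i> * of_real t) \<le> 2 * t"
        using norm_triangle_ineq4[of "complex_of_real t" "\<i> * of_real t"] t by (simp add: norm_mult)
      show "0 \<le> C / (1 + t\<^sup>2 / 2)" using C by (intro divide_nonneg_nonneg add_nonneg_nonneg) auto
    qed
    finally show ?thesis by (simp add: D_def)
  qed
  have "(LBINT t:{0<..}. f (of_real t) - \<i> * f (\<i> * of_real t)) = 0 - 0"
  proof (rule half_line_FTC)
    fix t :: real assume t: "t > 0"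
    have "((\<lambda>t. P (\<i> * of_real t)) has_vector_derivative f (\<i> * of_real t) * \<i>) (at t)"
    proof -
      have "((\<lambda>w. P (\<i> * w)) has_field_derivative f (\<i> * of_real t) * \<i>) (at (of_real t))"
        by (rule DERIV_chain2[OF P']) (use t in \<open>auto simp: U_def intro!: derivative_eq_intros\<close>)
      from has_vector_derivative_real_field[OF this] show ?thesis .
    qed
    moreover have "((\<lambda>t. P (of_real t)) has_vector_derivative f (of_real t)) (at t)"
      by (rule has_vector_derivative_real_field[OF P']) (use t in \<open>auto simp: U_def\<close>)
    ultimately have "(D has_vector_derivative f (of_real t) - f (\<i> * of_real t) * \<i>) (at t)"
      unfolding D_def by (intro has_vector_derivative_diff)
    then show "(D has_vector_derivative f (of_real t) - \<i> * f (\<i> * of_real t)) (at t)"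
      by (simp add: mult.commute)
    show "isCont (\<lambda>t. f (of_real t) - \<i> * f (\<i> * of_real t)) t"
      using t by (intro continuous_intros c1 c2)
  next
    show "set_integrable lborel {0<..} (\<lambda>t. f (of_real t) - \<i> * f (\<i> * of_real t))"
      by (intro set_integral_diff set_integrable_mult_right 1 2)
    show "(D \<longlongrightarrow> 0) (at_right 0)"
    proof (rule Lim_null_comparison)
      show "\<forall>\<^sub>F t in at_right 0. norm (D t) \<le> C / (1 + t\<^sup>2 / 2) * (2 * t)"
        using eventually_at_right_less[of 0] by eventually_elim (rule nD)
      show "((\<lambda>t. C / (1 + t\<^sup>2 / 2) * (2 * t)) \<longlongrightarrow> 0) (at_right 0)"
      proof -
        have "((\<lambda>t::real. 1 / (1 + t\<^sup>2 / 2) * (2 * t)) \<longlongrightarrow> 0) (at_right 0)" by real_asymp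
        then have "((\<lambda>t::real. C * (1 / (1 + t\<^sup>2 / 2) * (2 * t))) \<longlongrightarrow> C * 0) (at_right 0)" by (intro tendsto_intros)
        then show ?thesis by simp
      qed
    qed
    show "(D \<longlongrightarrow> 0) at_top"
    proof (rule Lim_null_comparison)
      show "\<forall>\<^sub>F t in at_top. norm (D t) \<le> C / (1 + t\<^sup>2 / 2) * (2 * t)"
        using eventually_gt_at_top[of 0] by eventually_elim (rule nD)
      have "((\<lambda>t::real. 1 / (1 + t\<^sup>2 / 2) * (2 * t)) \<longlongrightarrow> 0) at_top" by real_asymp
      then have "((\<lambda>t::real. C * (1 / (1 + t\<^sup>2 / 2) * (2 * t))) \<longlongrightarrow> C * 0) at_top" by (intro tendsto_intros)
      then show "((\<lambda>t. C / (1 + t\<^sup>2 / 2) * (2 * t)) \<longlongrightarrow> 0) at_top" by simp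
    qed
  qed
  moreover have "(LBINT t:{0<..}. f (of_real t) - \<i> * f (\<i> * of_real t)) =
      (LBINT t:{0<..}. f (of_real t)) - (LBINT t:{0<..}. \<i> * f (\<i> * of_real t))"
    by (intro set_integral_diff set_integrable_mult_right 1 2)
  ultimately show "(LBINT t:{0<..}. f (of_real t)) = \<i> * (LBINT t:{0<..}. f (\<i> * of_real t))"
    by simp
qed

text \<open>The Hankel function of the first kind of order zero.\<close>

definition Hankel_H :: "complex \<Rightarrow> complex" where
  "Hankel_H z = 2 / (pi * \<i>) * Macdonald (- \<i> * z)"

lemma Re_Hankel_H: "t > 0 \<Longrightarrow> Re (Hankel_H (of_real t)) = J0 t"
  using Im_Macdonald_imaginary[of t] by (simp add: Hankel_H_def Re_divide power2_eq_square field_simps)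

lemma Hankel_H_imaginary: "t > 0 \<Longrightarrow> Hankel_H (\<i> * of_real t) = 2 / (pi * \<i>) * of_real (K0 t)"
  using Macdonald_of_real[of t] by (simp add: Hankel_H_def flip: mult.assoc)

lemma Hankel_H_holomorphic: "Hankel_H holomorphic_on {z. 0 < Re z + Im z}"
proof -
  have "Macdonald \<circ> (\<lambda>z. - \<i> * z) holomorphic_on {z. 0 < Re z + Im z}"
    by (rule holomorphic_on_compose_gen[OF _ Macdonald_holomorphic]) (auto intro!: holomorphic_intros)
  then show ?thesis
    unfolding Hankel_H_def[abs_def] o_def by (intro holomorphic_intros)
qed

lemma norm_Hankel_H_le:
  assumes "0 < a" "a \<le> 1"
  obtains A where "A > 0" and "\<And>z. 0 \<le> Re z \<Longrightarrow> 0 \<le> Im z \<Longrightarrow> z \<noteq> 0 \<Longrightarrow>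
    norm (Hankel_H z) \<le> A * exp (- Im z) * norm z powr (- a / 2)"
proof -
  define G where "G = (LBINT y:{0<..}. y powr (a - 1) * exp (- y))"
  have "norm (Hankel_H z) \<le> (4 * \<bar>G\<bar> + 1) * exp (- Im z) * norm z powr (- a / 2)"
    if z: "0 \<le> Re z" "0 \<le> Im z" "z \<noteq> 0" for z
  proof -
    have "Im (- \<i> * z) < Re (- \<i> * z)"
      using z by (simp add: complex_eq_iff) linarith
    then have "norm (Macdonald (- \<i> * z)) \<le> 4 * G * exp (- Re (- \<i> * z)) * norm (- \<i> * z) powr (- a / 2)"
      unfolding G_def using z by (intro norm_Macdonald_le assms) auto
    also have "\<dots> = 4 * G * (exp (- Im z) * norm z powr (- a / 2))"
      by (simp add: norm_mult)
    also have "\<dots> \<le> (4 * \<bar>G\<bar> + 1) * (exp (- Im z) * norm z powr (- a / 2))"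
      by (intro mult_right_mono) auto
    finally have "norm (Macdonald (- \<i> * z)) \<le> (4 * \<bar>G\<bar> + 1) * (exp (- Im z) * norm z powr (- a / 2))" .
    moreover have "norm (Hankel_H z) \<le> 1 * norm (Macdonald (- \<i> * z))"
      unfolding Hankel_H_def norm_mult
      by (rule mult_right_mono) (use pi_gt3 in \<open>auto simp: norm_divide norm_mult\<close>)
    ultimately show ?thesis by (simp add: mult.assoc)
  qed
  then show ?thesis using that[of "4 * \<bar>G\<bar> + 1"] by auto
qed

section \<open>The rotated integrals\<close>

lemma exp_cancel:
  assumes "0 \<le> (y::real)" "k + 1 \<le> m"
  shows "exp y * exp y ^ k * exp (- y) ^ m \<le> 1"
proof -
  have "exp y ^ (k + 1) * exp (- y) ^ m \<le> exp y ^ (k + 1) * exp (- y) ^ (k + 1)"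
    using assms by (intro mult_left_mono power_decreasing) auto
  also have "\<dots> = 1"
    by (simp flip: power_mult_distrib exp_add del: power_Suc)
  finally show ?thesis by simp
qed

definition Bessel_product :: "real \<Rightarrow> nat \<Rightarrow> nat \<Rightarrow> complex \<Rightarrow> complex" where
  "Bessel_product x k m z = Bessel_J (of_real x * z) * Bessel_J z ^ k * Hankel_H z ^ m * z"

text \<open>The exponential factors cancel because \<open>m \<ge> k + 1\<close>. Outside the unit disc all seven factors without
  \<open>x\<close> decay like \<open>\<bar>z\<bar> powr (-1/2)\<close>; inside, the \<open>m\<close> Hankel factors grow at most like \<open>\<bar>z\<bar> powr (-1/8)\<close>
  each, which the factor \<open>z\<close> absorbs.\<close>

lemma norm_Bessel_product_le:
  assumes x: "0 \<le> x" "x \<le> 1" and km: "k + m = 7" "4 \<le> m"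
  obtains C where "\<And>z. 0 \<le> Re z \<Longrightarrow> 0 \<le> Im z \<Longrightarrow> z \<noteq> 0 \<Longrightarrow>
    norm (Bessel_product x k m z) \<le> C / (1 + (norm z)\<^sup>2)"
proof -
  obtain A1 where A1: "A1 > 0" "\<And>z. 0 \<le> Re z \<Longrightarrow> 0 \<le> Im z \<Longrightarrow> z \<noteq> 0 \<Longrightarrow>
    norm (Hankel_H z) \<le> A1 * exp (- Im z) * norm z powr (- 1 / 2)"
    using norm_Hankel_H_le[of 1] by auto
  obtain A2 where A2: "A2 > 0" "\<And>z. 0 \<le> Re z \<Longrightarrow> 0 \<le> Im z \<Longrightarrow> z \<noteq> 0 \<Longrightarrow>
    norm (Hankel_H z) \<le> A2 * exp (- Im z) * norm z powr (- (1 / 4) / 2)"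
    using norm_Hankel_H_le[of "1 / 4"] by auto
  define A where "A = max 4 (max A1 A2)"
  have A: "4 \<le> A" "A1 \<le> A" "A2 \<le> A" by (auto simp: A_def)
  have "norm (Bessel_product x k m z) \<le> 2 * A ^ 7 / (1 + (norm z)\<^sup>2)"
    if z: "0 \<le> Re z" "0 \<le> Im z" "z \<noteq> 0" for z
  proof -
    define y where "y = Im z"
    define r where "r = norm z"
    define E where "E = exp y * exp y ^ k * exp (- y) ^ m"
    have r: "r > 0" and y: "y \<ge> 0" using z by (auto simp: r_def y_def)
    have E: "0 \<le> E" "E \<le> 1" unfolding E_def using exp_cancel[OF y, of k m] km by auto
    have Jx: "norm (Bessel_J (of_real x * z)) \<le> exp y"
    proof -
      have "norm (Bessel_J (of_real x * z)) \<le> exp \<bar>Im (of_real x * z)\<bar>"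
        by (rule norm_Bessel_J_le_exp)
      also have "\<bar>Im (of_real x * z)\<bar> \<le> y"
        using x y mult_right_mono[of x 1 y] by (simp add: y_def[symmetric])
      finally show ?thesis by simp
    qed
    have product: "norm (Bessel_product x k m z) \<le> B ^ k * D ^ m * r * E"
      if "norm (Bessel_J z) \<le> B * exp y" "norm (Hankel_H z) \<le> D * exp (- y)" for B D
    proof -
      have "0 \<le> B * exp y" "0 \<le> D * exp (- y)"
        using that norm_ge_zero order_trans by blast+
      then have "norm (Bessel_product x k m z) \<le> exp y * (B * exp y) ^ k * (D * exp (- y)) ^ m * r"
        unfolding Bessel_product_def norm_mult norm_power r_def
        by (intro mult_mono power_mono Jx that) auto
      then show ?thesis by (simp add: power_mult_distrib E_def mult_ac)
    qed
    show ?thesis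
    proof (cases "r \<le> 1")
      case True
      define s where "s = r powr (- 1 / 8)"
      have "r powr (1 / 8) \<le> 1" using True r by (simp add: powr_le1)
      then have s: "1 \<le> s" using r by (simp add: s_def powr_minus one_le_inverse)
      have H: "norm (Hankel_H z) \<le> A * s * exp (- y)"
      proof -
        have "norm (Hankel_H z) \<le> A2 * (exp (- y) * s)"
          using A2(2)[OF z] by (simp add: y_def r_def s_def mult.assoc)
        also have "\<dots> \<le> A * (exp (- y) * s)"
          using s A by (intro mult_right_mono) auto
        finally show ?thesis by (simp add: mult_ac)
      qed
      have J: "norm (Bessel_J z) \<le> 1 * exp y"
        using norm_Bessel_J_le_exp[of z] y by (simp add: y_def)
      have "s ^ m * r \<le> s ^ 7 * r"
        using s r km by (intro mult_right_mono power_increasing) auto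
      also have "s ^ 7 * r = r powr (1 / 8)"
      proof -
        have "s ^ 7 = r powr (- 7 / 8)"
          using r by (simp add: s_def powr_powr flip: powr_realpow)
        then have "s ^ 7 * r = r powr (- 7 / 8) * r powr 1" using r by simp
        also have "\<dots> = r powr (- 7 / 8 + 1)" by (rule powr_add[symmetric])
        finally show ?thesis by simp
      qed
      also have "\<dots> \<le> 1" using True r by (simp add: powr_le1)
      finally have sr: "s ^ m * r \<le> 1" .
      have "norm (Bessel_product x k m z) \<le> 1 ^ k * (A * s) ^ m * r * E"
        by (rule product[OF J H])
      also have "\<dots> = A ^ m * (s ^ m * r) * E" by (simp add: power_mult_distrib mult_ac)
      also have "\<dots> \<le> A ^ 7 * 1 * 1"
        using A E s r sr km by (intro mult_mono power_increasing) auto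
      also have "\<dots> \<le> 2 * A ^ 7 / (1 + (norm z)\<^sup>2)"
      proof -
        have "r\<^sup>2 \<le> 1" using True r by (simp add: power_le_one)
        then have "A ^ 7 * (1 + r\<^sup>2) \<le> A ^ 7 * 2" using A by (intro mult_left_mono) auto
        moreover have "0 < 1 + r\<^sup>2" by (simp add: add_pos_nonneg)
        ultimately show ?thesis unfolding r_def[symmetric] by (simp add: pos_le_divide_eq mult_ac)
      qed
      finally show ?thesis .
    next
      case False
      define s where "s = r powr (- 1 / 2)"
      have s: "s = 1 / sqrt r" using r by (simp add: s_def powr_minus_divide powr_half_sqrt)
      have s0: "s \<ge> 0" by (simp add: s_def)
      have H: "norm (Hankel_H z) \<le> A * s * exp (- y)"
      proof -
        have "norm (Hankel_H z) \<le> A1 * (exp (- y) * s)"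
          using A1(2)[OF z] by (simp add: y_def r_def s_def mult.assoc)
        also have "\<dots> \<le> A * (exp (- y) * s)"
          using s0 A by (intro mult_right_mono) auto
        finally show ?thesis by (simp add: mult_ac)
      qed
      have J: "norm (Bessel_J z) \<le> A * s * exp y"
      proof -
        have "norm (Bessel_J z) \<le> 4 * (exp y * s)"
          using norm_Bessel_J_le[of z] z y by (simp add: y_def s r_def)
        also have "\<dots> \<le> A * (exp y * s)"
          using s0 A by (intro mult_right_mono) auto
        finally show ?thesis by (simp add: mult_ac)
      qed
      have "s ^ 7 * r = r powr (- 5 / 2)"
      proof -
        have "s ^ 7 = r powr (- 7 / 2)"
          using r by (simp add: s_def powr_powr flip: powr_realpow)
        then have "s ^ 7 * r = r powr (- 7 / 2) * r powr 1" using r by simp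
        also have "\<dots> = r powr (- 7 / 2 + 1)" by (rule powr_add[symmetric])
        finally show ?thesis by simp
      qed
      also have "\<dots> \<le> r powr (- 2)" using False by (intro powr_mono) auto
      also have "\<dots> = 1 / r\<^sup>2" using r by (simp add: powr_minus_divide)
      also have "\<dots> \<le> 2 / (1 + r\<^sup>2)"
        using False r by (simp add: divide_simps add_pos_nonneg)
      finally have sr: "s ^ 7 * r \<le> 2 / (1 + r\<^sup>2)" .
      have "norm (Bessel_product x k m z) \<le> (A * s) ^ k * (A * s) ^ m * r * E"
        by (rule product[OF J H])
      also have "\<dots> = A ^ 7 * (s ^ 7 * r) * E"
      proof -
        have "(A * s) ^ k * (A * s) ^ m = (A * s) ^ 7"
          by (simp only: power_add[symmetric] km)
        then show ?thesis by (simp add: power_mult_distrib mult_ac)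
      qed
      also have "\<dots> \<le> A ^ 7 * (2 / (1 + r\<^sup>2)) * 1"
        using A E s0 r sr by (intro mult_mono mult_nonneg_nonneg divide_nonneg_nonneg add_nonneg_nonneg) auto
      finally show ?thesis by (simp add: r_def mult_ac)
    qed
  qed
  then show ?thesis by (rule that)
qed

definition IK_moment :: "real \<Rightarrow> nat \<Rightarrow> nat \<Rightarrow> real" where
  "IK_moment x k m = (LBINT t:{0<..}. I0 (x * t) * I0 t ^ k * K0 t ^ m * t)"

lemma Bessel_product_holomorphic: "Bessel_product x k m holomorphic_on {z. 0 < Re z + Im z}"
  unfolding Bessel_product_def[abs_def]
  by (intro holomorphic_intros Hankel_H_holomorphic)

lemma Bessel_product_imaginary:
  assumes "t > 0"
  shows "Bessel_product x k m (\<i> * of_real t) =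
    \<i> * (2 / (pi * \<i>)) ^ m * of_real (I0 (x * t) * I0 t ^ k * K0 t ^ m * t)"
proof -
  have "of_real x * (\<i> * of_real t) = \<i> * of_real (x * t)" by simp
  then have "Bessel_J (of_real x * (\<i> * of_real t)) = of_real (I0 (x * t))"
    by (simp only: Bessel_J_imaginary)
  then show ?thesis
    unfolding Bessel_product_def Bessel_J_imaginary Hankel_H_imaginary[OF assms]
    by (simp add: power_divide power_mult_distrib mult_ac)
qed

lemma set_integrable_Re:
  "set_integrable M A f \<Longrightarrow> set_integrable M A (\<lambda>x. Re (f x))"
  unfolding set_integrable_def by (drule integrable_Re) simp

lemma set_integral_Re:
  "set_integrable M A f \<Longrightarrow> (LINT x:A|M. Re (f x)) = Re (LINT x:A|M. f x)"
  unfolding set_integrable_def set_lebesgue_integral_def by (drule integral_Re) simp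

text \<open>
  The minus sign comes from two factors \<open>\<i>\<close>: the rotated line element and the factor \<open>z\<close> of the integrand.
\<close>

lemma
  assumes "0 \<le> x" "x \<le> 1" "k + m = 7" "4 \<le> m"
  shows set_integrable_Bessel_product: "set_integrable lborel {0<..} (\<lambda>t. Bessel_product x k m (of_real t))"
    and set_integrable_IK: "set_integrable lborel {0<..} (\<lambda>t. I0 (x * t) * I0 t ^ k * K0 t ^ m * t)"
    and Bessel_product_integral: "(LBINT t:{0<..}. Bessel_product x k m (of_real t)) =
      - ((2 / (pi * \<i>)) ^ m) * of_real (IK_moment x k m)"
proof -
  obtain C where C: "\<And>z. 0 \<le> Re z \<Longrightarrow> 0 \<le> Im z \<Longrightarrow> z \<noteq> 0 \<Longrightarrow>
    norm (Bessel_product x k m z) \<le> C / (1 + (norm z)\<^sup>2)"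
    using norm_Bessel_product_le[OF assms] by blast
  note q = Bessel_product_holomorphic[of x k m] C
  show "set_integrable lborel {0<..} (\<lambda>t. Bessel_product x k m (of_real t))"
    by (rule set_integrable_quadrant_real[OF q])
  define c where "c = \<i> * (2 / (pi * \<i>)) ^ m"
  define w where "w t = I0 (x * t) * I0 t ^ k * K0 t ^ m * t" for t
  have c: "c \<noteq> 0" by (simp add: c_def)
  have im: "Bessel_product x k m (\<i> * of_real t) = c * of_real (w t)" if "t > 0" for t
    unfolding c_def w_def by (rule Bessel_product_imaginary[OF that])
  have "set_integrable lborel {0<..} (\<lambda>t. Bessel_product x k m (\<i> * of_real t))"
    by (rule set_integrable_quadrant_imaginary[OF q])
  also have "?this \<longleftrightarrow> set_integrable lborel {0<..} (\<lambda>t. c * of_real (w t))"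
    by (intro set_integrable_cong refl im) simp
  finally have "set_integrable lborel {0<..} (\<lambda>t. inverse c * (c * of_real (w t)))"
    by (rule set_integrable_mult_right)
  then have "set_integrable lborel {0<..} (\<lambda>t. Re (inverse c * (c * of_real (w t))))"
    by (rule set_integrable_Re)
  also have "(\<lambda>t. Re (inverse c * (c * of_real (w t)))) = w"
    using c by (simp add: fun_eq_iff mult.assoc[symmetric])
  finally show "set_integrable lborel {0<..} w" .
  have "(LBINT t:{0<..}. Bessel_product x k m (of_real t)) = \<i> * (LBINT t:{0<..}. Bessel_product x k m (\<i> * of_real t))"
    by (rule quadrant_rotation[OF q])
  also have "(LBINT t:{0<..}. Bessel_product x k m (\<i> * of_real t)) = (LBINT t:{0<..}. c * of_real (w t))"
    by (intro set_lebesgue_integral_cong) (auto intro: im)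
  also have "\<dots> = c * of_real (IK_moment x k m)"
    unfolding IK_moment_def w_def[symmetric] by (simp only: set_integral_mult_right set_integral_complex_of_real)
  finally show "(LBINT t:{0<..}. Bessel_product x k m (of_real t)) =
      - ((2 / (pi * \<i>)) ^ m) * of_real (IK_moment x k m)"
    by (simp add: c_def flip: mult.assoc)
qed

text \<open>The coefficients solve the linear system that makes \<open>y ^ 2\<close>, \<open>y ^ 4\<close> and \<open>y ^ 6\<close> disappear, where
  \<open>y = Im h\<close>, and normalises the coefficient of \<open>j ^ 7\<close>.\<close>

lemma seventh_power_eq_Re:
  assumes "Re h = j"
  shows "j ^ 7 = 35 / 16 * Re (of_real j * h ^ 6) + 35 / 8 * Re (of_real j ^ 3 * h ^ 4)
     - 5 / 16 * Re (h ^ 7) - 21 / 4 * Re (of_real j ^ 2 * h ^ 5)"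
proof -
  obtain y where "h = Complex j y" using assms by (metis complex.collapse)
  then show ?thesis
    by (simp add: eval_nat_numeral) (simp add: field_simps)
qed

text \<open>Of the four rotated integrals, those with \<open>m = 5\<close> and \<open>m = 7\<close> have real part zero, since an odd
  power of \<open>2 / (pi * \<i>)\<close> is purely imaginary.\<close>

lemma p7_eq_IK_moments:
  assumes x: "0 \<le> x" "x \<le> 1"
  shows "p7 x / 35 = x * (4 / pi ^ 6 * IK_moment x 1 6 - 2 / pi ^ 4 * IK_moment x 3 4)"
proof -
  define R where "R k m t = Re (Bessel_product x k m (of_real t))" for k m t
  have int: "set_integrable lborel {0<..} (R k m)" if "k + m = 7" "4 \<le> m" for k m
    unfolding R_def by (intro set_integrable_Re set_integrable_Bessel_product x that)
  have val: "(LBINT t:{0<..}. R k m t) = - Re ((2 / (pi * \<i>)) ^ m) * IK_moment x k m" if "k + m = 7" "4 \<le> m" for k m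
    unfolding R_def set_integral_Re[OF set_integrable_Bessel_product[OF x that]]
      Bessel_product_integral[OF x that] by simp
  have "J0 (x * t) * J0 t ^ 7 * (x * t) =
     x * (35 / 16 * R 1 6 t + 35 / 8 * R 3 4 t - 5 / 16 * R 0 7 t - 21 / 4 * R 2 5 t)" if t: "t > 0" for t
  proof -
    define h where "h = Hankel_H (of_real t)"
    have R: "R k m t = J0 (x * t) * t * Re (of_real (J0 t) ^ k * h ^ m)" for k m
    proof -
      have Re_of_real_mult: "Re (of_real a * z) = a * Re z" for a z by simp
      have "Bessel_product x k m (of_real t) = of_real (J0 (x * t) * t) * (of_real (J0 t) ^ k * h ^ m)"
        unfolding Bessel_product_def h_def Bessel_J_of_real of_real_mult[symmetric]
        by (simp add: mult_ac)
      then show ?thesis unfolding R_def by (simp only: Re_of_real_mult)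
    qed
    have "Re h = J0 t" unfolding h_def by (rule Re_Hankel_H[OF t])
    from seventh_power_eq_Re[OF this] show ?thesis
      unfolding R by (simp only:) (simp add: algebra_simps)
  qed
  then have "p7 x = (LBINT t:{0<..}. x * (35 / 16 * R 1 6 t + 35 / 8 * R 3 4 t - 5 / 16 * R 0 7 t - 21 / 4 * R 2 5 t))"
    unfolding p7_def by (intro set_lebesgue_integral_cong) auto
  also have "\<dots> = x * (35 / 16 * (LBINT t:{0<..}. R 1 6 t) + 35 / 8 * (LBINT t:{0<..}. R 3 4 t)
      - 5 / 16 * (LBINT t:{0<..}. R 0 7 t) - 21 / 4 * (LBINT t:{0<..}. R 2 5 t))"
    by (simp add: int)
  also have "\<dots> = x * (35 / 16 * (64 / pi ^ 6 * IK_moment x 1 6) - 35 / 8 * (16 / pi ^ 4 * IK_moment x 3 4))"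
  proof -
    have i: "(2 / (of_real pi * \<i>)) = of_real (2 / pi) * (- \<i>)"
      by (simp add: complex_eq_iff Re_divide Im_divide power2_eq_square)
    have e: "Re ((2 / (of_real pi * \<i>)) ^ m) = (2 / pi) ^ m * Re ((- \<i>) ^ m)" for m
      unfolding i power_mult_distrib by (simp flip: of_real_power)
    have "Re ((2 / (of_real pi * \<i>)) ^ 4) = 16 / pi ^ 4" "Re ((2 / (of_real pi * \<i>)) ^ 6) = - (64 / pi ^ 6)"
      "Re ((2 / (of_real pi * \<i>)) ^ 5) = 0" "Re ((2 / (of_real pi * \<i>)) ^ 7) = 0"
      unfolding e by (simp_all add: power_divide) (simp_all add: eval_nat_numeral)
    then show ?thesis by (simp add: val)
  qed
  finally show ?thesis by (simp add: field_simps)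
qed

section \<open>The Maclaurin series\<close>

lemma I0_nonneg: "0 \<le> I0 t"
  unfolding I0_def set_lebesgue_integral_def
  by (intro mult_nonneg_nonneg Bochner_Integration.integral_nonneg) auto

lemma K0_nonneg: "0 \<le> K0 t"
  unfolding K0_def set_lebesgue_integral_def
  by (intro Bochner_Integration.integral_nonneg) auto

text \<open>The coefficients of the moment \<open>IK_moment x k m\<close> as a power series in \<open>x\<close>.\<close>

definition IK_coeff :: "nat \<Rightarrow> nat \<Rightarrow> nat \<Rightarrow> real" where
  "IK_coeff k m n = 1 / (4 ^ n * (fact n)\<^sup>2) * (LBINT t:{0<..}. I0 t ^ k * K0 t ^ m * t ^ (2 * n + 1))"

text \<open>
  Termwise integration of the series of \<open>I0 (x * t)\<close>. Every term is nonnegative, so single terms and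
  partial sums are dominated by the full integrand, whose integrability up to \<open>x = 1\<close> is known.
\<close>

lemma
  assumes km: "k + m = 7" "4 \<le> m"
  shows set_integrable_IK_power: "set_integrable lborel {0<..} (\<lambda>t. I0 t ^ k * K0 t ^ m * t ^ (2 * n + 1))"
    and IK_moment_sums: "0 \<le> x \<Longrightarrow> x \<le> 1 \<Longrightarrow> (\<lambda>n. IK_coeff k m n * x ^ (2 * n)) sums IK_moment x k m"
proof -
  define w where "w t = I0 t ^ k * K0 t ^ m * t" for t
  have w0: "0 \<le> w t" if "t > 0" for t
    using that I0_nonneg K0_nonneg by (simp add: w_def)
  have I0_0: "I0 0 = 1"
    by (simp add: I0_def set_lebesgue_integral_def)
  \<comment> \<open>the moment at \<open>x = 0\<close> has the bare weight as its integrand\<close>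
  have "set_integrable lborel {0<..} (\<lambda>t. I0 (0 * t) * I0 t ^ k * K0 t ^ m * t)"
    by (rule set_integrable_IK[OF _ _ km]) auto
  then have intw: "set_integrable lborel {0<..} w"
    by (simp add: I0_0 w_def[abs_def])
  define g where "g x n t = (x * t / 2) ^ (2 * n) / (fact n)\<^sup>2 * w t" for x t :: real and n
  have gsums: "(\<lambda>n. g x n t) sums (I0 (x * t) * w t)" for x t
    unfolding g_def by (intro sums_mult2 I0_sums)
  have g0: "0 \<le> g x n t" if "t > 0" for x n t
    using w0[OF that] by (simp add: g_def)
  have gle: "(\<Sum>i<n. g x i t) \<le> I0 (x * t) * w t" if "t > 0" for x n t
    using sum_le_suminf[of "\<lambda>n. g x n t" "{..<n}"] gsums[of x t] g0[OF that] by (auto simp: sums_iff)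
  have gle1: "g x n t \<le> I0 (x * t) * w t" if "t > 0" for x n t
    using sum_le_suminf[of "\<lambda>n. g x n t" "{n}"] gsums[of x t] g0[OF that] by (auto simp: sums_iff)
  have intI: "set_integrable lborel {0<..} (\<lambda>t. I0 (x * t) * w t)" if "0 \<le> x" "x \<le> 1" for x
    using set_integrable_IK[OF that km] by (simp add: w_def mult.assoc)
  have intg: "set_integrable lborel {0<..} (g x n)" if x: "0 \<le> x" "x \<le> 1" for x n
  proof (rule set_integrable_bound[OF intI[OF x]])
    have "(\<lambda>t. ((x * t / 2) ^ (2 * n) / (fact n)\<^sup>2) * (indicator {0<..} t *\<^sub>R w t)) \<in> borel_measurable lborel"
      using intw unfolding set_integrable_def by (intro borel_measurable_times) (auto dest: borel_measurable_integrable)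
    then show "set_borel_measurable lborel {0<..} (g x n)"
      unfolding set_borel_measurable_def g_def by (simp add: mult_ac)
    show "AE t\<in>{0<..} in lborel. norm (g x n t) \<le> norm (I0 (x * t) * w t)"
    proof (intro AE_I2 impI)
      fix t :: real assume "t \<in> {0<..}"
      then show "norm (g x n t) \<le> norm (I0 (x * t) * w t)"
        using gle1[of t x n] g0[of t x n] by simp
    qed
  qed
  have gc: "g x n t = x ^ (2 * n) * (1 / (4 ^ n * (fact n)\<^sup>2)) * (I0 t ^ k * K0 t ^ m * t ^ (2 * n + 1))" for x n t
  proof -
    have "(2 ^ n)\<^sup>2 = (4::real) ^ n" by (simp add: power2_eq_square flip: power_mult_distrib)
    then show ?thesis
      by (simp add: g_def w_def power_mult_distrib power_divide power_mult mult_ac)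
  qed
  show "set_integrable lborel {0<..} (\<lambda>t. I0 t ^ k * K0 t ^ m * t ^ (2 * n + 1))" for n
  proof -
    have "set_integrable lborel {0<..} (\<lambda>t. (4 ^ n * (fact n)\<^sup>2) * g 1 n t)"
      by (intro set_integrable_mult_right intg) auto
    then show ?thesis unfolding gc by simp
  qed
  have gi: "(LBINT t:{0<..}. g x n t) = IK_coeff k m n * x ^ (2 * n)" for x n
    unfolding gc set_integral_mult_right IK_coeff_def by simp
  assume x: "0 \<le> x" "x \<le> 1"
  define h where "h n t = indicator {0<..} t *\<^sub>R g x n t" for n t
  have inth: "integrable lborel (h n)" for n
    using intg[OF x] by (simp add: h_def[abs_def] set_integrable_def)
  have h0: "0 \<le> h n t" for n t using g0 by (simp add: h_def indicator_def)
  have hsums: "(\<lambda>n. h n t) sums (indicator {0<..} t *\<^sub>R (I0 (x * t) * w t))" for t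
    unfolding h_def by (intro sums_scaleR_right gsums)
  have "summable (\<lambda>n. LBINT t. norm (h n t))"
  proof (rule summableI_nonneg_bounded)
    fix n
    show "0 \<le> (LBINT t. norm (h n t))" by (rule Bochner_Integration.integral_nonneg) simp
    have "(\<Sum>i<n. LBINT t. norm (h i t)) = (LBINT t. (\<Sum>i<n. h i t))"
      using inth h0 by (subst Bochner_Integration.integral_sum) auto
    also have "\<dots> \<le> (LBINT t. indicator {0<..} t *\<^sub>R (I0 (x * t) * w t))"
    proof (rule integral_mono)
      show "integrable lborel (\<lambda>t. \<Sum>i<n. h i t)"
        using inth by (intro Bochner_Integration.integrable_sum)
      show "integrable lborel (\<lambda>t. indicator {0<..} t *\<^sub>R (I0 (x * t) * w t))"
        using intI[OF x] by (simp add: set_integrable_def)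
      show "(\<Sum>i<n. h i t) \<le> indicator {0<..} t *\<^sub>R (I0 (x * t) * w t)" for t
        using gle[of t x n] by (cases "t > 0") (auto simp: h_def)
    qed
    finally show "(\<Sum>i<n. LBINT t. norm (h i t)) \<le> (LBINT t. indicator {0<..} t *\<^sub>R (I0 (x * t) * w t))" .
  qed
  moreover have "summable (\<lambda>n. norm (h n t))" for t
    using hsums[of t] h0 by (auto simp: sums_iff)
  ultimately have "(\<lambda>n. LBINT t. h n t) sums (LBINT t. (\<Sum>n. h n t))"
    using inth by (intro sums_integral) auto
  moreover have "(\<Sum>n. h n t) = indicator {0<..} t *\<^sub>R (I0 (x * t) * w t)" for t
    using hsums[of t] by (simp add: sums_iff)
  moreover have "(LBINT t. h n t) = IK_coeff k m n * x ^ (2 * n)" for n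
    using gi[of x n] by (simp add: h_def set_lebesgue_integral_def)
  moreover have "(LBINT t. indicator {0<..} t *\<^sub>R (I0 (x * t) * w t)) = IK_moment x k m"
    by (simp add: IK_moment_def w_def set_lebesgue_integral_def mult.assoc)
  ultimately show "(\<lambda>n. IK_coeff k m n * x ^ (2 * n)) sums IK_moment x k m"
    by simp
qed

lemma IK_coeff_nonneg: "0 \<le> IK_coeff k m n"
  unfolding IK_coeff_def set_lebesgue_integral_def
  using I0_nonneg K0_nonneg
  by (intro mult_nonneg_nonneg Bochner_Integration.integral_nonneg) (auto simp: indicator_def)

lemma r7_eq: "r7 n = 35 * (4 / pi ^ 6 * IK_coeff 1 6 n - 2 / pi ^ 4 * IK_coeff 3 4 n)"
proof -
  have "(I0 t * K0 t ^ 6 - pi\<^sup>2 / 2 * I0 t ^ 3 * K0 t ^ 4) * t ^ (2 * n + 1) =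
      I0 t ^ 1 * K0 t ^ 6 * t ^ (2 * n + 1) - pi\<^sup>2 / 2 * (I0 t ^ 3 * K0 t ^ 4 * t ^ (2 * n + 1))" for t
    by (simp add: algebra_simps)
  then have "(LBINT t:{0<..}. (I0 t * K0 t ^ 6 - pi\<^sup>2 / 2 * I0 t ^ 3 * K0 t ^ 4) * t ^ (2 * n + 1)) =
      (LBINT t:{0<..}. I0 t ^ 1 * K0 t ^ 6 * t ^ (2 * n + 1)) -
      (LBINT t:{0<..}. pi\<^sup>2 / 2 * (I0 t ^ 3 * K0 t ^ 4 * t ^ (2 * n + 1)))"
    by (simp only:) (intro set_integral_diff set_integrable_mult_right set_integrable_IK_power; simp)
  then show ?thesis
    unfolding r7_def IK_coeff_def set_integral_mult_right
    by (simp add: field_simps eval_nat_numeral)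
qed

lemma r7_series_sums:
  assumes "0 \<le> x" "x \<le> 1"
  shows "(\<lambda>n. r7 n * x ^ (2 * n + 1)) sums p7 x"
proof -
  have "(\<lambda>n. 35 * x * (4 / pi ^ 6 * (IK_coeff 1 6 n * x ^ (2 * n)) - 2 / pi ^ 4 * (IK_coeff 3 4 n * x ^ (2 * n))))
      sums (35 * x * (4 / pi ^ 6 * IK_moment x 1 6 - 2 / pi ^ 4 * IK_moment x 3 4))"
    using assms by (intro sums_mult sums_diff IK_moment_sums) auto
  moreover have "35 * x * (4 / pi ^ 6 * IK_moment x 1 6 - 2 / pi ^ 4 * IK_moment x 3 4) = p7 x"
    using p7_eq_IK_moments[OF assms] by simp
  moreover have "35 * x * (4 / pi ^ 6 * (IK_coeff 1 6 n * x ^ (2 * n)) - 2 / pi ^ 4 * (IK_coeff 3 4 n * x ^ (2 * n)))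
     = r7 n * x ^ (2 * n + 1)" for n
    unfolding r7_eq by (simp add: algebra_simps)
  ultimately show ?thesis by (simp only:)
qed

text \<open>Each coefficient \<open>r7 n\<close> is a difference of two nonnegative terms whose sums over \<open>n\<close> are the moments at
  \<open>x = 1\<close>; the sum of the two terms is therefore a summable majorant on the unit interval.\<close>

lemma r7_series_uniform_limit:
  "uniform_limit {0..1} (\<lambda>n x. \<Sum>k<n. r7 k * x ^ (2 * k + 1)) p7 sequentially"
proof -
  define M where "M n = 35 * (4 / pi ^ 6 * IK_coeff 1 6 n + 2 / pi ^ 4 * IK_coeff 3 4 n)" for n
  have "uniform_limit {0..1} (\<lambda>n x. \<Sum>k<n. r7 k * x ^ (2 * k + 1)) (\<lambda>x. \<Sum>k. r7 k * x ^ (2 * k + 1)) sequentially"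
  proof (rule Weierstrass_m_test)
    show "norm (r7 n * x ^ (2 * n + 1)) \<le> M n" if "x \<in> {0..1}" for n and x :: real
    proof -
      have "norm (r7 n * x ^ (2 * n + 1)) = \<bar>r7 n\<bar> * x ^ (2 * n + 1)"
        using that by (simp add: abs_mult)
      also have "\<dots> \<le> \<bar>r7 n\<bar> * 1"
        using that by (intro mult_left_mono power_le_one) auto
      also have "\<bar>r7 n\<bar> \<le> M n"
        using IK_coeff_nonneg[of 1 6 n] IK_coeff_nonneg[of 3 4 n]
        unfolding r7_eq M_def abs_mult
        by (intro mult_mono order_trans[OF abs_triangle_ineq4]) auto
      finally show ?thesis by simp
    qed
    show "summable M"
      using IK_moment_sums[of 1 6 1] IK_moment_sums[of 3 4 1] unfolding M_def
      by (intro summable_mult summable_add) (auto simp: sums_iff)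
  qed
  also have "?this \<longleftrightarrow> ?thesis"
    by (intro uniform_limit_cong always_eventually allI ballI refl)
       (use r7_series_sums in \<open>auto simp: sums_iff\<close>)
  finally show ?thesis .
qed

theorem theorem4p2:
  shows "(\<forall>x\<in>{0..1}.
           p7 x / 35 =
             4 / pi ^ 6 * (LBINT t:{0<..}. I0 (x * t) * I0 t * (K0 t) ^ 6 * (x * t))
           - 2 / pi ^ 4 * (LBINT t:{0<..}. I0 (x * t) * (I0 t) ^ 3 * (K0 t) ^ 4 * (x * t)))
       \<and> uniform_limit {0..1} (\<lambda>n x. \<Sum>k<n. r7 k * x ^ (2 * k + 1)) p7 sequentially"
proof (intro conjI ballI r7_series_uniform_limit)
  fix x :: real assume "x \<in> {0..1}"
  then have x: "0 \<le> x" "x \<le> 1" by auto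
  have pull: "(LBINT t:{0<..}. I0 (x * t) * I0 t ^ k * K0 t ^ m * (x * t)) = x * IK_moment x k m" for k m
  proof -
    have "I0 (x * t) * I0 t ^ k * K0 t ^ m * (x * t) = x * (I0 (x * t) * I0 t ^ k * K0 t ^ m * t)" for t
      by (simp add: mult_ac)
    then show ?thesis unfolding IK_moment_def by (simp only: set_integral_mult_right)
  qed
  show "p7 x / 35 =
             4 / pi ^ 6 * (LBINT t:{0<..}. I0 (x * t) * I0 t * (K0 t) ^ 6 * (x * t))
           - 2 / pi ^ 4 * (LBINT t:{0<..}. I0 (x * t) * (I0 t) ^ 3 * (K0 t) ^ 4 * (x * t))"
    using p7_eq_IK_moments[OF x] pull[of 1 6] pull[of 3 4] by (simp add: algebra_simps)
qed


end
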